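(* Let $\mathcal{B}$ be a complex Banach space, let $\Omega\subseteq\mathbb{D}$ be an open neighborhood of the origin, and let $\phi:\Omega\to\mathbf{L}(\mathcal{B},\mathcal{B}^* )$ be a function which is weakly continuous at the origin, in the sense that $\langle\phi(z)b,b\rangle_{\mathcal{B}}\to\langle\phi(0)b,b\rangle_{\mathcal{B}}$ as $z\to 0$ for every $b\in\mathcal{B}$. Then $\phi$ is a Carath\'eodory function if and only if it admits the representation $$\phi(z)^*\big|_{\mathcal{B}}=D+C^*(I-z^*V)^{-1}(I+z^*V)C,\quad z\in\Omega,$$ or, equivalently, $$\phi(z)=D^*\big|_{\mathcal{B}}+C^*(I+zV^* )(I-zV^* )^{-1}C,\quad z\in\Omega,$$ where $V$ is an isometric operator in some Hilbert space $\mathcal{H}$, $C$ is a bounded operator from $\mathcal{B}$ into $\mathcal{H}$, and $D$ is a purely imaginary operator from $\mathcal{B}$ into $\mathcal{B}^*$, in the sense that $D+D^*\big|_{\mathcal{B}}=0$. In particular, every Carath\'eodory function has an analytic extension to the whole open unit disk $\mathbb{D}$.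
   Context: $\mathbb{D}$ is the open unit disk in $\mathbb{C}$, and $z^*$ denotes the complex conjugate of $z\in\mathbb{C}$. For a complex Banach space $\mathcal{B}$, $\mathcal{B}^*$ denotes its conjugate dual, i.e. the space of bounded anti-linear functionals on $\mathcal{B}$, and $\langle b_*,b\rangle_{\mathcal{B}}:=b_*(b)$ for $b\in\mathcal{B}$, $b_*\in\mathcal{B}^*$. $\mathbf{L}(X,Y)$ denotes the space of bounded linear operators from $X$ to $Y$. The natural injection $\tau:\mathcal{B}\to\mathcal{B}^{**}$ is defined by $\langle\tau(b),b_*\rangle_{\mathcal{B}^*}=\overline{\langle b_*,b\rangle_{\mathcal{B}}}$. For $A\in\mathbf{L}(\mathcal{B},\mathcal{B}^* )$, $A^*\in\mathbf{L}(\mathcal{B}^{**},\mathcal{B}^* )$ is the adjoint, and $A^*\big|_{\mathcal{B}}:=A^*\tau\in\mathbf{L}(\mathcal{B},\mathcal{B}^* )$; thus $\langle A^*\big|_{\mathcal{B}}c,b\rangle_{\mathcal{B}}=\overline{\langle Ab,c\rangle_{\mathcal{B}}}$ for $b,c\in\mathcal{B}$. For a Hilbert space $\mathcal{H}$ (identified with its conjugate dual) and $C\in\mathbf{L}(\mathcal{B},\mathcal{H})$, the adjoint $C^*\in\mathbf{L}(\mathcal{H},\mathcal{B}^* )$ is given by $\langle C^*h,b\rangle_{\mathcal{B}}=\langle h,Cb\rangle_{\mathcal{H}}$; $V^*$ is the Hilbert space adjoint of $V$. An $\mathbf{L}(\mathcal{B},\mathcal{B}^* )$-valued kernel $K(z,w)$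 on $\Omega\times\Omega$ is called positive if for every $n$, all $z_1,\dots,z_n\in\Omega$ and all $b_1,\dots,b_n\in\mathcal{B}$ one has $\sum_{i,j=1}^n\langle K(z_i,z_j)b_j,b_i\rangle_{\mathcal{B}}\ge 0$. An $\mathbf{L}(\mathcal{B},\mathcal{B}^* )$-valued function $\phi$ defined in an open neighborhood $\Omega$ of the origin and weakly continuous at the origin is called a Carath\'eodory function if the kernel $$k_\phi(z,w)=\frac{\phi(z)+\phi(w)^*\big|_{\mathcal{B}}}{2(1-zw^* )}$$ is positive in $\Omega$. *)

theory Defs
  imports "HOL-Analysis.Analysis" "HOL-Library.Function_Algebras"
begin

section \<open>Complex normed and Banach spaces\<close>

class scaleC =
  fixes scaleC :: "complex \<Rightarrow> 'a \<Rightarrow> 'a"  (infixr \<open>*\<^sub>C\<close> 75)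

class complex_vector = scaleC + ab_group_add +
  assumes scaleC_add_right: "c *\<^sub>C (x + y) = c *\<^sub>C x + c *\<^sub>C y"
    and scaleC_add_left: "(c + d) *\<^sub>C x = c *\<^sub>C x + d *\<^sub>C x"
    and scaleC_scaleC: "c *\<^sub>C (d *\<^sub>C x) = (c * d) *\<^sub>C x"
    and scaleC_one: "1 *\<^sub>C x = x"

class complex_normed_vector = complex_vector + real_normed_vector +
  assumes scaleR_scaleC: "scaleR r x = complex_of_real r *\<^sub>C x"
    and norm_scaleC: "norm (c *\<^sub>C x) = cmod c * norm x"

class complex_banach = complex_normed_vector + banach

instantiation complex :: complex_banach
begin

definition scaleC_complex :: "complex \<Rightarrow> complex \<Rightarrow> complex"
  where "scaleC_complex c x = c * x"

instance
  by standard (auto simp: scaleC_complex_def algebra_simps norm_mult scaleR_conv_of_real)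

end

instantiation "fun" :: (type, complex_vector) complex_vector
begin

definition scaleC_fun :: "complex \<Rightarrow> ('a \<Rightarrow> 'b) \<Rightarrow> 'a \<Rightarrow> 'b"
  where "scaleC_fun c f = (\<lambda>x. c *\<^sub>C f x)"

instance
  by standard
    (auto simp: scaleC_fun_def fun_eq_iff scaleC_add_right scaleC_add_left scaleC_scaleC scaleC_one)

end

lemma bounded_linear_scaleC_right:
  "bounded_linear (\<lambda>x::'a::complex_normed_vector. c *\<^sub>C x)"
proof (rule bounded_linear_intro[where K = "cmod c"])
  fix r :: real and x :: 'a
  show "c *\<^sub>C (r *\<^sub>R x) = r *\<^sub>R (c *\<^sub>C x)"
    by (simp add: scaleR_scaleC scaleC_scaleC mult.commute)
qed (simp_all add: scaleC_add_right norm_scaleC mult.commute)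

lemma onorm_scaleC:
  fixes f :: "'a::real_normed_vector \<Rightarrow> 'b::complex_normed_vector"
  assumes "bounded_linear f"
  shows "onorm (\<lambda>x. c *\<^sub>C f x) = cmod c * onorm f"
proof -
  have "onorm (\<lambda>x. c *\<^sub>C f x) = onorm (\<lambda>x. cmod c *\<^sub>R f x)"
    by (simp add: onorm_def norm_scaleC)
  also have "\<dots> = cmod c * onorm f"
    using onorm_scaleR[OF assms, of "cmod c"] by simp
  finally show ?thesis .
qed

lemma onorm_cmult:
  fixes f :: "'a::real_normed_vector \<Rightarrow> complex"
  assumes "bounded_linear f"
  shows "onorm (\<lambda>x. c * f x) = cmod c * onorm f"
  using onorm_scaleC[OF assms, of c] by (simp add: scaleC_complex_def)

section \<open>Bounded complex-linear operators\<close>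

typedef (overloaded) ('a, 'b) cblinfun =
  "{f :: 'a::complex_normed_vector \<Rightarrow> 'b::complex_normed_vector.
      bounded_linear f \<and> (\<forall>c x. f (c *\<^sub>C x) = c *\<^sub>C f x)}"
  morphisms cblinfun_apply CBlinfun
proof (rule exI[of _ "\<lambda>_. 0"], safe)
  fix c
  show "(0::'b) = c *\<^sub>C 0"
    using scaleC_add_right[of c "0::'b" 0] by simp
qed simp

notation cblinfun_apply (infixl \<open>*\<^sub>V\<close> 72)

setup_lifting type_definition_cblinfun

lemma scaleC_zero [simp]: "c *\<^sub>C (0::'a::complex_vector) = 0"
  using scaleC_add_right[of c "0::'a" 0] by simp

lemma scaleC_minus_right: "c *\<^sub>C (- x) = - (c *\<^sub>C (x::'a::complex_vector))"
  using scaleC_add_right[of c x "- x"] by (simp add: eq_neg_iff_add_eq_0 add.commute)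

lemma scaleC_diff_right: "c *\<^sub>C (x - y) = c *\<^sub>C x - c *\<^sub>C (y::'a::complex_vector)"
  using scaleC_add_right[of c x "- y"] by (simp add: scaleC_minus_right)

instantiation cblinfun :: (complex_normed_vector, complex_normed_vector) complex_normed_vector
begin

lift_definition norm_cblinfun :: "('a, 'b) cblinfun \<Rightarrow> real" is onorm .

lift_definition zero_cblinfun :: "('a, 'b) cblinfun" is "\<lambda>x. 0"
  by simp

lift_definition plus_cblinfun :: "('a, 'b) cblinfun \<Rightarrow> ('a, 'b) cblinfun \<Rightarrow> ('a, 'b) cblinfun"
  is "\<lambda>f g x. f x + g x"
  by (auto simp: scaleC_add_right bounded_linear_add)

lift_definition minus_cblinfun :: "('a, 'b) cblinfun \<Rightarrow> ('a, 'b) cblinfun \<Rightarrow> ('a, 'b) cblinfun"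
  is "\<lambda>f g x. f x - g x"
  by (auto simp: scaleC_diff_right bounded_linear_sub)

lift_definition uminus_cblinfun :: "('a, 'b) cblinfun \<Rightarrow> ('a, 'b) cblinfun"
  is "\<lambda>f x. - f x"
  by (auto simp: scaleC_minus_right bounded_linear_minus)

lift_definition scaleC_cblinfun :: "complex \<Rightarrow> ('a, 'b) cblinfun \<Rightarrow> ('a, 'b) cblinfun"
  is "\<lambda>c f x. c *\<^sub>C f x"
  by (auto simp: scaleC_scaleC mult.commute
      intro: bounded_linear_compose[OF bounded_linear_scaleC_right])

definition scaleR_cblinfun :: "real \<Rightarrow> ('a, 'b) cblinfun \<Rightarrow> ('a, 'b) cblinfun"
  where "scaleR_cblinfun r f = complex_of_real r *\<^sub>C f"

definition dist_cblinfun :: "('a, 'b) cblinfun \<Rightarrow> ('a, 'b) cblinfun \<Rightarrow> real"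
  where "dist_cblinfun f g = norm (f - g)"

definition uniformity_cblinfun :: "(('a, 'b) cblinfun \<times> ('a, 'b) cblinfun) filter"
  where "uniformity_cblinfun = (INF e\<in>{0 <..}. principal {(x, y). dist x y < e})"

definition open_cblinfun :: "('a, 'b) cblinfun set \<Rightarrow> bool"
  where "open_cblinfun S = (\<forall>x\<in>S. \<forall>\<^sub>F (x', y) in uniformity. x' = x \<longrightarrow> y \<in> S)"

definition sgn_cblinfun :: "('a, 'b) cblinfun \<Rightarrow> ('a, 'b) cblinfun"
  where "sgn_cblinfun x = scaleR (inverse (norm x)) x"

instance
  apply standard
  unfolding dist_cblinfun_def open_cblinfun_def sgn_cblinfun_def uniformity_cblinfun_def
    scaleR_cblinfun_def
  apply (rule refl | (transfer, force simp: onorm_triangle onorm_scaleC onorm_eq_0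
        scaleC_add_right scaleC_add_left scaleC_scaleC scaleC_one algebra_simps))+
  done

end

lift_definition cblinfun_compose ::
  "('b::complex_normed_vector, 'c::complex_normed_vector) cblinfun \<Rightarrow>
   ('a::complex_normed_vector, 'b) cblinfun \<Rightarrow> ('a, 'c) cblinfun"  (infixl \<open>o\<^sub>C\<close> 67)
  is "\<lambda>f g x. f (g x)"
  by (auto intro: bounded_linear_compose)

section \<open>The conjugate dual\<close>

text \<open>Bounded antilinear functionals; scalars act by \<open>\<langle>c f, b\<rangle> = c \<langle>f, b\<rangle>\<close>.\<close>

typedef (overloaded) 'a cdual =
  "{f :: 'a::complex_normed_vector \<Rightarrow> complex.
      bounded_linear f \<and> (\<forall>c x. f (c *\<^sub>C x) = cnj c * f x)}"
  morphisms cdual_apply CDual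
  by (rule exI[of _ "\<lambda>_. 0"]) simp

notation cdual_apply (\<open>\<langle>_, _\<rangle>\<close>)

setup_lifting type_definition_cdual

instantiation cdual :: (complex_normed_vector) complex_normed_vector
begin

lift_definition norm_cdual :: "'a cdual \<Rightarrow> real" is onorm .

lift_definition zero_cdual :: "'a cdual" is "\<lambda>x. 0"
  by simp

lift_definition plus_cdual :: "'a cdual \<Rightarrow> 'a cdual \<Rightarrow> 'a cdual"
  is "\<lambda>f g x. f x + g x"
  by (auto simp: distrib_left bounded_linear_add)

lift_definition minus_cdual :: "'a cdual \<Rightarrow> 'a cdual \<Rightarrow> 'a cdual"
  is "\<lambda>f g x. f x - g x"
  by (auto simp: right_diff_distrib bounded_linear_sub)

lift_definition uminus_cdual :: "'a cdual \<Rightarrow> 'a cdual"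
  is "\<lambda>f x. - f x"
  by (auto simp: bounded_linear_minus)

lift_definition scaleC_cdual :: "complex \<Rightarrow> 'a cdual \<Rightarrow> 'a cdual"
  is "\<lambda>c f x. c * f x"
  by (auto intro: bounded_linear_const_mult)

definition scaleR_cdual :: "real \<Rightarrow> 'a cdual \<Rightarrow> 'a cdual"
  where "scaleR_cdual r f = complex_of_real r *\<^sub>C f"

definition dist_cdual :: "'a cdual \<Rightarrow> 'a cdual \<Rightarrow> real"
  where "dist_cdual f g = norm (f - g)"

definition uniformity_cdual :: "('a cdual \<times> 'a cdual) filter"
  where "uniformity_cdual = (INF e\<in>{0 <..}. principal {(x, y). dist x y < e})"

definition open_cdual :: "'a cdual set \<Rightarrow> bool"
  where "open_cdual S = (\<forall>x\<in>S. \<forall>\<^sub>F (x', y) in uniformity. x' = x \<longrightarrow> y \<in> S)"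

definition sgn_cdual :: "'a cdual \<Rightarrow> 'a cdual"
  where "sgn_cdual x = scaleR (inverse (norm x)) x"

instance
  apply standard
  unfolding dist_cdual_def open_cdual_def sgn_cdual_def uniformity_cdual_def scaleR_cdual_def
  apply (rule refl | (transfer, simp add: onorm_cmult; fail)
      | (transfer, force simp: onorm_triangle onorm_eq_0 algebra_simps))+
  done

end

lemma norm_cdual_apply: "cmod \<langle>f, x\<rangle> \<le> norm f * norm x"
  by transfer (simp add: onorm)

lemma norm_cblinfun_apply: "norm (A *\<^sub>V x) \<le> norm A * norm x"
  by transfer (simp add: onorm)

lemma norm_cdual_bound:
  assumes "0 \<le> K" "\<And>x. cmod \<langle>f, x\<rangle> \<le> K * norm x"
  shows "norm f \<le> K"
  using assms by transfer (rule onorm_bound)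

lemma cdual_add_right: "\<langle>f, x + y\<rangle> = \<langle>f, x\<rangle> + \<langle>f, y\<rangle>"
  by transfer (simp add: bounded_linear.linear linear_add)

lemma cdual_scaleC_right: "\<langle>f, c *\<^sub>C x\<rangle> = cnj c * \<langle>f, x\<rangle>"
  by transfer simp

lemma cdual_eqI: "(\<And>x. \<langle>f, x\<rangle> = \<langle>g, x\<rangle>) \<Longrightarrow> f = g"
  by transfer auto

lemma cblinfun_eqI: "(\<And>x. A *\<^sub>V x = B *\<^sub>V x) \<Longrightarrow> A = B"
  by transfer auto

section \<open>Adjoints\<close>

lift_definition cdual_pullback ::
  "('a::complex_normed_vector, 'b::complex_normed_vector) cblinfun \<Rightarrow> 'b cdual \<Rightarrow> 'a cdual"
  is "\<lambda>A f x. f (A x)"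
  by (auto intro: bounded_linear_compose)

lift_definition cadjoint ::
  "('a::complex_normed_vector, 'b::complex_normed_vector) cblinfun \<Rightarrow> ('b cdual, 'a cdual) cblinfun"
  is cdual_pullback
proof (intro conjI allI)
  fix A :: "('a, 'b) cblinfun"
  show hom: "cdual_pullback A (c *\<^sub>C f) = c *\<^sub>C cdual_pullback A f" for c f
    by transfer simp
  show "bounded_linear (cdual_pullback A)"
  proof (rule bounded_linear_intro[where K = "norm A"])
    show "cdual_pullback A (f + g) = cdual_pullback A f + cdual_pullback A g" for f g
      by transfer simp
    show "cdual_pullback A (r *\<^sub>R f) = r *\<^sub>R cdual_pullback A f" for r f
      by (simp add: scaleR_scaleC hom)
    show "norm (cdual_pullback A f) \<le> norm f * norm A" for f
    proof (rule norm_cdual_bound)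
      fix x
      have "cmod \<langle>f, A *\<^sub>V x\<rangle> \<le> norm f * norm (A *\<^sub>V x)"
        by (rule norm_cdual_apply)
      also have "\<dots> \<le> norm f * (norm A * norm x)"
        by (intro mult_left_mono norm_cblinfun_apply) simp
      finally show "cmod \<langle>cdual_pullback A f, x\<rangle> \<le> norm f * norm A * norm x"
        by (simp add: cdual_pullback.rep_eq mult.assoc)
    qed simp
  qed
qed

text \<open>The natural injection into the second conjugate dual. The conjugation makes
  \<open>natural_injection b\<close> antilinear in \<open>f\<close> and linear in \<open>b\<close>.\<close>

lift_definition cdual_eval :: "'a::complex_normed_vector \<Rightarrow> 'a cdual cdual"
  is "\<lambda>b f. cnj \<langle>f, b\<rangle>"
proof (intro conjI allI)
  fix b :: 'a
  show hom: "cnj \<langle>c *\<^sub>C f, b\<rangle> = cnj c * cnj \<langle>f, b\<rangle>" for c f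
    by transfer simp
  show "bounded_linear (\<lambda>f. cnj \<langle>f, b\<rangle>)"
  proof (rule bounded_linear_intro[where K = "norm b"])
    show "cnj \<langle>f + g, b\<rangle> = cnj \<langle>f, b\<rangle> + cnj \<langle>g, b\<rangle>" for f g
      by transfer simp
    show "cnj \<langle>r *\<^sub>R f, b\<rangle> = r *\<^sub>R cnj \<langle>f, b\<rangle>" for r f
      by (simp only: scaleR_scaleC[of r f] hom) (simp add: scaleR_conv_of_real)
    show "cmod (cnj \<langle>f, b\<rangle>) \<le> norm f * norm b" for f
      by (simp add: norm_cdual_apply)
  qed
qed

lift_definition natural_injection :: "('a::complex_normed_vector, 'a cdual cdual) cblinfun"
  is cdual_eval
proof (intro conjI allI)
  show hom: "cdual_eval (c *\<^sub>C b) = c *\<^sub>C cdual_eval b" for c and b :: 'a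
    by (rule cdual_eqI)
      (simp add: cdual_eval.rep_eq scaleC_cdual.rep_eq cdual_scaleC_right)
  show "bounded_linear (cdual_eval :: 'a \<Rightarrow> _)"
  proof (rule bounded_linear_intro[where K = 1])
    show "cdual_eval (b + c) = cdual_eval b + cdual_eval c" for b c :: 'a
      by (rule cdual_eqI)
        (simp add: cdual_eval.rep_eq plus_cdual.rep_eq cdual_add_right)
    show "cdual_eval (r *\<^sub>R b) = r *\<^sub>R cdual_eval b" for r and b :: 'a
      by (simp add: scaleR_scaleC hom)
    show "norm (cdual_eval b) \<le> norm b * 1" for b :: 'a
    proof (rule norm_cdual_bound)
      show "cmod \<langle>cdual_eval b, f\<rangle> \<le> norm b * 1 * norm f" for f
        using norm_cdual_apply[of f b] by (simp add: cdual_eval.rep_eq mult.commute)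
    qed simp
  qed
qed

text \<open>\<open>A\<^sup>*\<close> restricted to the original space, i.e. \<open>A\<^sup>* \<tau>\<close>.\<close>

definition adjoint_restrict ::
  "('a::complex_normed_vector, 'a cdual) cblinfun \<Rightarrow> ('a, 'a cdual) cblinfun"
  where "adjoint_restrict A = cadjoint A o\<^sub>C natural_injection"

lemma adjoint_restrict_apply: "\<langle>adjoint_restrict A *\<^sub>V c, b\<rangle> = cnj \<langle>A *\<^sub>V b, c\<rangle>"
  by (simp add: adjoint_restrict_def cblinfun_compose.rep_eq cadjoint.rep_eq
      cdual_pullback.rep_eq natural_injection.rep_eq cdual_eval.rep_eq)

section \<open>Hilbert spaces\<close>

text \<open>A Hilbert space is given by a linear subspace \<open>H\<close> of an ambient complex vector space and
  an inner product on \<open>H\<close>; it need not come from a norm of the ambient space. (A Hilbert space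
  whose existence is asserted cannot be a type, since HOL does not quantify over types.) The inner
  product is linear in its first argument, in agreement with \<open>\<langle>f, b\<rangle>\<close> being antilinear
  in \<open>b\<close>, and \<open>ip\<close> is unconstrained outside of \<open>H\<close>.\<close>

definition ip_norm :: "('h \<Rightarrow> 'h \<Rightarrow> complex) \<Rightarrow> 'h \<Rightarrow> real"
  where "ip_norm ip x = sqrt (Re (ip x x))"

locale complex_hilbert_space =
  fixes H :: "'h::complex_vector set" and ip :: "'h \<Rightarrow> 'h \<Rightarrow> complex"
  assumes zero_mem: "0 \<in> H"
    and add_mem: "\<lbrakk>x \<in> H; y \<in> H\<rbrakk> \<Longrightarrow> x + y \<in> H"
    and scaleC_mem: "x \<in> H \<Longrightarrow> c *\<^sub>C x \<in> H"
    and ip_add_left: "\<lbrakk>x \<in> H; y \<in> H; z \<in> H\<rbrakk> \<Longrightarrow> ip (x + y) z = ip x z + ip y z"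
    and ip_scaleC_left: "\<lbrakk>x \<in> H; y \<in> H\<rbrakk> \<Longrightarrow> ip (c *\<^sub>C x) y = c * ip x y"
    and ip_commute: "\<lbrakk>x \<in> H; y \<in> H\<rbrakk> \<Longrightarrow> ip y x = cnj (ip x y)"
    and ip_pos: "\<lbrakk>x \<in> H; x \<noteq> 0\<rbrakk> \<Longrightarrow> 0 < Re (ip x x)"
    and complete:
      "\<lbrakk>\<And>n. X n \<in> H; \<And>e. e > 0 \<Longrightarrow> \<exists>N. \<forall>m\<ge>N. \<forall>n\<ge>N. ip_norm ip (X m - X n) < e\<rbrakk>
        \<Longrightarrow> \<exists>L\<in>H. (\<lambda>n. ip_norm ip (X n - L)) \<longlonglongrightarrow> 0"

definition isometry_in :: "'h::complex_vector set \<Rightarrow> ('h \<Rightarrow> 'h \<Rightarrow> complex) \<Rightarrow> ('h \<Rightarrow> 'h) \<Rightarrow> bool"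
  where "isometry_in H ip V \<longleftrightarrow>
    (\<forall>x\<in>H. V x \<in> H \<and> ip_norm ip (V x) = ip_norm ip x) \<and>
    (\<forall>x\<in>H. \<forall>y\<in>H. V (x + y) = V x + V y) \<and>
    (\<forall>c. \<forall>x\<in>H. V (c *\<^sub>C x) = c *\<^sub>C V x)"

definition bounded_op_into ::
  "'h::complex_vector set \<Rightarrow> ('h \<Rightarrow> 'h \<Rightarrow> complex) \<Rightarrow> ('b::complex_normed_vector \<Rightarrow> 'h) \<Rightarrow> bool"
  where "bounded_op_into H ip C \<longleftrightarrow>
    (\<forall>b. C b \<in> H) \<and>
    (\<forall>b c. C (b + c) = C b + C c) \<and>
    (\<forall>a b. C (a *\<^sub>C b) = a *\<^sub>C C b) \<and>
    (\<exists>M. \<forall>b. ip_norm ip (C b) \<le> M * norm b)"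

definition hilbert_adjoint ::
  "'h set \<Rightarrow> ('h \<Rightarrow> 'h \<Rightarrow> complex) \<Rightarrow> ('h \<Rightarrow> 'h) \<Rightarrow> 'h \<Rightarrow> 'h"
  where "hilbert_adjoint H ip V h = (THE g. g \<in> H \<and> (\<forall>k\<in>H. ip g k = ip h (V k)))"

definition adjoint_to_cdual ::
  "('h \<Rightarrow> 'h \<Rightarrow> complex) \<Rightarrow> ('b::complex_normed_vector \<Rightarrow> 'h) \<Rightarrow> 'h \<Rightarrow> 'b cdual"
  where "adjoint_to_cdual ip C h = (THE f. \<forall>b. \<langle>f, b\<rangle> = ip h (C b))"

section \<open>Caratheodory functions and their representations\<close>

definition positive_kernel ::
  "complex set \<Rightarrow> (complex \<Rightarrow> complex \<Rightarrow> ('b::complex_normed_vector, 'b cdual) cblinfun) \<Rightarrow> bool"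
  where "positive_kernel \<Omega> K \<longleftrightarrow>
    (\<forall>n. \<forall>z :: nat \<Rightarrow> complex. \<forall>b :: nat \<Rightarrow> 'b. (\<forall>i<n. z i \<in> \<Omega>) \<longrightarrow>
      (\<Sum>i<n. \<Sum>j<n. \<langle>K (z i) (z j) *\<^sub>V b j, b i\<rangle>) \<in> \<real>\<^sub>\<ge>\<^sub>0)"

definition caratheodory_kernel ::
  "(complex \<Rightarrow> ('b::complex_normed_vector, 'b cdual) cblinfun) \<Rightarrow>
   complex \<Rightarrow> complex \<Rightarrow> ('b, 'b cdual) cblinfun"
  where "caratheodory_kernel \<phi> z w =
    (1 / (2 * (1 - z * cnj w))) *\<^sub>C (\<phi> z + adjoint_restrict (\<phi> w))"

definition weakly_continuous_at_origin ::
  "complex set \<Rightarrow> (complex \<Rightarrow> ('b::complex_normed_vector, 'b cdual) cblinfun) \<Rightarrow> bool"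
  where "weakly_continuous_at_origin \<Omega> \<phi> \<longleftrightarrow>
    (\<forall>b. ((\<lambda>z. \<langle>\<phi> z *\<^sub>V b, b\<rangle>) \<longlongrightarrow> \<langle>\<phi> 0 *\<^sub>V b, b\<rangle>) (at 0 within \<Omega>))"

definition caratheodory_function ::
  "complex set \<Rightarrow> (complex \<Rightarrow> ('b::complex_banach, 'b cdual) cblinfun) \<Rightarrow> bool"
  where "caratheodory_function \<Omega> \<phi> \<longleftrightarrow>
    open \<Omega> \<and> 0 \<in> \<Omega> \<and> weakly_continuous_at_origin \<Omega> \<phi> \<and>
    positive_kernel \<Omega> (caratheodory_kernel \<phi>)"

definition representation_data ::
  "'h::complex_vector set \<Rightarrow> ('h \<Rightarrow> 'h \<Rightarrow> complex) \<Rightarrow> ('h \<Rightarrow> 'h) \<Rightarrow>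
   ('b::complex_banach \<Rightarrow> 'h) \<Rightarrow> ('b, 'b cdual) cblinfun \<Rightarrow> bool"
  where "representation_data H ip V C D \<longleftrightarrow>
    complex_hilbert_space H ip \<and> isometry_in H ip V \<and> bounded_op_into H ip C \<and>
    D + adjoint_restrict D = 0"

text \<open>The two operator identities below are evaluated at \<open>b\<close>. The inverses
  are those of operators on \<open>H\<close>, which are bijective on \<open>H\<close> for \<open>|z| < 1\<close> since \<open>V\<close> is isometric.\<close>

definition represents_adjoint ::
  "complex set \<Rightarrow> (complex \<Rightarrow> ('b::complex_banach, 'b cdual) cblinfun) \<Rightarrow>
   'h::complex_vector set \<Rightarrow> ('h \<Rightarrow> 'h \<Rightarrow> complex) \<Rightarrow> ('h \<Rightarrow> 'h) \<Rightarrow>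
   ('b \<Rightarrow> 'h) \<Rightarrow> ('b, 'b cdual) cblinfun \<Rightarrow> bool"
  where "represents_adjoint \<Omega> \<phi> H ip V C D \<longleftrightarrow>
    (\<forall>z\<in>\<Omega>. \<forall>b. adjoint_restrict (\<phi> z) *\<^sub>V b =
      D *\<^sub>V b + adjoint_to_cdual ip C
        (inv_into H (\<lambda>h. h - cnj z *\<^sub>C V h) (C b + cnj z *\<^sub>C V (C b))))"

definition represents ::
  "complex set \<Rightarrow> (complex \<Rightarrow> ('b::complex_banach, 'b cdual) cblinfun) \<Rightarrow>
   'h::complex_vector set \<Rightarrow> ('h \<Rightarrow> 'h \<Rightarrow> complex) \<Rightarrow> ('h \<Rightarrow> 'h) \<Rightarrow>
   ('b \<Rightarrow> 'h) \<Rightarrow> ('b, 'b cdual) cblinfun \<Rightarrow> bool"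
  where "represents \<Omega> \<phi> H ip V C D \<longleftrightarrow>
    (\<forall>z\<in>\<Omega>. \<forall>b. \<phi> z *\<^sub>V b =
      adjoint_restrict D *\<^sub>V b +
      (let V' = hilbert_adjoint H ip V;
           g = inv_into H (\<lambda>h. h - z *\<^sub>C V' h) (C b)
       in adjoint_to_cdual ip C (g + z *\<^sub>C V' g)))"

text \<open>Complex differentiability with respect to the norm (for operator-valued functions: the
  operator norm). On open sets this is analyticity.\<close>

definition vector_holomorphic_on ::
  "(complex \<Rightarrow> 'a::complex_normed_vector) \<Rightarrow> complex set \<Rightarrow> bool"
  where "vector_holomorphic_on f S \<longleftrightarrow>
    (\<forall>z\<in>S. \<exists>f'. (f has_derivative (\<lambda>h. h *\<^sub>C f')) (at z within S))"

end

theory Submission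
  imports Defs
begin

text \<open>
  Write \<open>k(z,w)\<close> for the Caratheodory kernel of \<open>\<phi>\<close>. The theorem rests on the identity
  \<open>k(z,w) - k(z,0) - k(0,w) + k(0,0) = z w\<^sup>* k(z,w)\<close>, which holds because
  \<open>(1 - z w\<^sup>*) k(z,w)\<close> is a function of \<open>z\<close> plus a function of \<open>w\<close>.

  If \<open>k\<close> is positive, it is the kernel of a Hilbert space with kernel functions
  \<open>k\<^sub>w b = k(\<cdot>,w) b\<close>, and the identity says that \<open>w\<^sup>* k\<^sub>w b \<mapsto> k\<^sub>w b - k\<^sub>0 b\<close> preserves inner
  products. Weak continuity at the origin makes \<open>k\<^sub>w b\<close> converge to \<open>k\<^sub>0 b\<close>, hence makes the domain
  of this map dense, and the map extends to an isometry \<open>V\<close> with \<open>(I - w\<^sup>* V) k\<^sub>w b = k\<^sub>0 b\<close>. With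
  \<open>C b = k\<^sub>0 b\<close> this reads \<open>k\<^sub>w b = (I - w\<^sup>* V)\<^sup>-\<^sup>1 C b\<close>, and evaluating \<open>2 k\<^sub>w b - k\<^sub>0 b\<close> at
  \<open>0\<close> gives \<open>\<phi>(w)\<^sup>* b\<close> up to the imaginary part of \<open>\<phi>(0)\<close> (\<open>caratheodory_function_represents\<close>).

  Conversely, a representation gives \<open>\<langle>k(z,w) b, c\<rangle> = \<langle>(I - w\<^sup>* V)\<^sup>-\<^sup>1 C b, (I - z\<^sup>* V)\<^sup>-\<^sup>1 C c\<rangle>\<close>
  since \<open>V\<close> is isometric (\<open>kernel_eq_ip_resolvents\<close>), and a Gram matrix is positive. The two forms
  of the representation are adjoint to each other (\<open>represents_adjoint_iff_represents\<close>), because the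
  resolvent of \<open>V\<^sup>*\<close> is the adjoint of the resolvent of \<open>V\<close>. The second form makes sense on the
  whole disk and depends on \<open>z\<close> through \<open>(I - z V\<^sup>*)\<^sup>-\<^sup>1\<close> only, which is analytic in operator norm
  by the resolvent identity (\<open>holomorphic_compressed_resolvent\<close>).

  The Hilbert space theory behind this is: the Riesz representation theorem, which provides
  \<open>V\<^sup>*\<close>; the bijectivity of \<open>I - c A\<close> for contractions \<open>A\<close> and \<open>|c| < 1\<close>; the construction of the
  space of a positive kernel; and the extension of isometries from dense subspaces.
\<close>

section \<open>Operators given by sesquilinear forms\<close>

lemma scaleC_zero_left [simp]: "0 *\<^sub>C (x::'a::complex_vector) = 0"
  using scaleC_add_left[of 0 0 x] by simp

lemma scaleC_minus_left: "(- c) *\<^sub>C (x::'a::complex_vector) = - (c *\<^sub>C x)"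
  using scaleC_add_left[of c "- c" x] by (simp add: eq_neg_iff_add_eq_0 add.commute)

lemma scaleC_minus_one: "(-1) *\<^sub>C (x::'a::complex_vector) = - x"
  by (simp add: scaleC_minus_left scaleC_one)

lemma scaleC_diff_left: "(c - d) *\<^sub>C (x::'a::complex_vector) = c *\<^sub>C x - d *\<^sub>C x"
  using scaleC_add_left[of c "- d" x] by (simp add: scaleC_minus_left)

lemmas cdual_rep_eq = plus_cdual.rep_eq minus_cdual.rep_eq uminus_cdual.rep_eq zero_cdual.rep_eq
  scaleC_cdual.rep_eq

lemmas cblinfun_rep_eq = plus_cblinfun.rep_eq minus_cblinfun.rep_eq uminus_cblinfun.rep_eq
  zero_cblinfun.rep_eq scaleC_cblinfun.rep_eq

lemma cblinfun_add_right: "A *\<^sub>V (x + y) = A *\<^sub>V x + A *\<^sub>V y"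
  by transfer (simp add: bounded_linear.linear linear_add)

lemma cblinfun_scaleC_right: "A *\<^sub>V (c *\<^sub>C x) = c *\<^sub>C (A *\<^sub>V x)"
  by transfer simp

lemma norm_cblinfun_bound:
  assumes "0 \<le> K" "\<And>x. norm (A *\<^sub>V x) \<le> K * norm x"
  shows "norm A \<le> K"
  using assms by transfer (rule onorm_bound)

lemma ex_cdual:
  fixes f :: "'b::complex_normed_vector \<Rightarrow> complex"
  assumes add: "\<And>x y. f (x + y) = f x + f y"
    and scale: "\<And>c x. f (c *\<^sub>C x) = cnj c * f x"
    and bound: "\<And>x. cmod (f x) \<le> K * norm x"
  shows "\<exists>g. \<forall>x. \<langle>g, x\<rangle> = f x"
proof -
  have "bounded_linear f"
  proof (rule bounded_linear_intro[where K = K])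
    show "f (r *\<^sub>R x) = r *\<^sub>R f x" for r x
      by (simp add: scaleR_scaleC[of r x] scale) (simp add: scaleR_conv_of_real)
    show "cmod (f x) \<le> norm x * K" for x
      using bound[of x] by (simp add: mult.commute)
  qed (rule add)
  then have "\<langle>CDual f, x\<rangle> = f x" for x
    by (subst CDual_inverse) (use scale in auto)
  then show ?thesis by blast
qed

lemma ex_cblinfun_of_sesquilinear:
  fixes s :: "'a::complex_normed_vector \<Rightarrow> 'b::complex_normed_vector \<Rightarrow> complex"
  assumes add_left: "\<And>x x' y. s (x + x') y = s x y + s x' y"
    and scale_left: "\<And>c x y. s (c *\<^sub>C x) y = c * s x y"
    and add_right: "\<And>x y y'. s x (y + y') = s x y + s x y'"
    and scale_right: "\<And>c x y. s x (c *\<^sub>C y) = cnj c * s x y"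
    and K: "0 \<le> K" and bound: "\<And>x y. cmod (s x y) \<le> K * norm x * norm y"
  shows "\<exists>A :: ('a, 'b cdual) cblinfun. \<forall>x y. \<langle>A *\<^sub>V x, y\<rangle> = s x y"
proof -
  have "\<exists>g. \<forall>y. \<langle>g, y\<rangle> = s x y" for x
    by (rule ex_cdual[where K = "K * norm x"]) (simp_all add: add_right scale_right bound)
  then obtain g where g: "\<And>x y. \<langle>g x, y\<rangle> = s x y" by metis
  have hom: "g (c *\<^sub>C x) = c *\<^sub>C g x" for c x
    by (rule cdual_eqI) (simp add: g scale_left cdual_rep_eq)
  have "bounded_linear g"
  proof (rule bounded_linear_intro[where K = K])
    show "g (x + y) = g x + g y" for x y
      by (rule cdual_eqI) (simp add: g add_left cdual_rep_eq)
    show "g (r *\<^sub>R x) = r *\<^sub>R g x" for r x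
      by (simp add: scaleR_scaleC hom)
    show "norm (g x) \<le> norm x * K" for x
      by (rule norm_cdual_bound) (use K bound[of x] in \<open>simp_all add: g mult.commute\<close>)
  qed
  then have "CBlinfun g *\<^sub>V x = g x" for x
    by (subst CBlinfun_inverse) (use hom in auto)
  then show ?thesis using g by (intro exI[of _ "CBlinfun g"]) simp
qed

lemma norm_cblinfun_cdual_le:
  fixes A :: "('a::complex_normed_vector, 'b::complex_normed_vector cdual) cblinfun"
  assumes "0 \<le> K" "\<And>x y. cmod \<langle>A *\<^sub>V x, y\<rangle> \<le> K * norm x * norm y"
  shows "norm A \<le> K"
  by (intro norm_cblinfun_bound norm_cdual_bound) (use assms in auto)

section \<open>Hilbert space geometry\<close>

text \<open>The discriminant argument behind Cauchy-Schwarz, with a constant \<open>M\<close> so that it also serves for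
  suprema: evaluate at the vertex \<open>c = a / s\<close>, or for \<open>s = 0\<close> along the direction of \<open>a\<close>.\<close>

lemma complex_quadratic_bound:
  fixes a :: complex and s M :: real
  assumes "\<And>c. 2 * Re (cnj c * a) - (cmod c)\<^sup>2 * s \<le> M" and "0 \<le> s"
  shows "(cmod a)\<^sup>2 \<le> M * s"
proof (cases "s = 0")
  case True
  have "a = 0"
  proof (rule ccontr)
    assume "a \<noteq> 0"
    have "2 * Re (cnj (of_real t * a) * a) = 2 * (t * (cmod a)\<^sup>2)" for t
      by (simp add: cmod_power2) (simp add: power2_eq_square algebra_simps)
    then have "2 * (t * (cmod a)\<^sup>2) \<le> M" for t
      using assms(1)[of "of_real t * a"] True by simp
    from this[of "(M + 1) / (2 * (cmod a)\<^sup>2)"] show False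
      using \<open>a \<noteq> 0\<close> by (simp add: field_simps)
  qed
  then show ?thesis using True by simp
next
  case False
  then have s: "s > 0" using assms(2) by simp
  have "2 * Re (cnj (a / of_real s) * a) - (cmod (a / of_real s))\<^sup>2 * s = (cmod a)\<^sup>2 / s"
    using s by (simp add: cmod_power2 norm_divide power_divide)
      (simp add: power2_eq_square field_simps)
  then have "(cmod a)\<^sup>2 / s \<le> M"
    using assms(1)[of "a / of_real s"] by simp
  then show ?thesis using s by (simp add: field_simps)
qed

definition contraction_in :: "'h::complex_vector set \<Rightarrow> ('h \<Rightarrow> 'h \<Rightarrow> complex) \<Rightarrow> ('h \<Rightarrow> 'h) \<Rightarrow> bool"
  where "contraction_in H ip A \<longleftrightarrow>
    (\<forall>x\<in>H. A x \<in> H \<and> ip_norm ip (A x) \<le> ip_norm ip x) \<and>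
    (\<forall>x\<in>H. \<forall>y\<in>H. A (x + y) = A x + A y) \<and>
    (\<forall>c. \<forall>x\<in>H. A (c *\<^sub>C x) = c *\<^sub>C A x)"

lemma isometry_imp_contraction: "isometry_in H ip V \<Longrightarrow> contraction_in H ip V"
  by (simp add: isometry_in_def contraction_in_def)

context complex_hilbert_space
begin

abbreviation hnorm :: "'h \<Rightarrow> real"  (\<open>\<parallel>_\<parallel>\<close>)
  where "\<parallel>x\<parallel> \<equiv> ip_norm ip x"

lemma uminus_mem: "x \<in> H \<Longrightarrow> - x \<in> H"
  using scaleC_mem[of x "-1"] by (simp add: scaleC_minus_one)

lemma diff_mem: "x \<in> H \<Longrightarrow> y \<in> H \<Longrightarrow> x - y \<in> H"
  using add_mem[OF _ uminus_mem] by fastforce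

lemma sum_mem: "(\<And>i. i \<in> I \<Longrightarrow> f i \<in> H) \<Longrightarrow> sum f I \<in> H"
  by (induction I rule: infinite_finite_induct) (auto intro: zero_mem add_mem)

lemmas mem_intros = zero_mem add_mem scaleC_mem uminus_mem diff_mem

lemma ip_add_right: "\<lbrakk>x \<in> H; y \<in> H; z \<in> H\<rbrakk> \<Longrightarrow> ip x (y + z) = ip x y + ip x z"
  by (simp add: ip_commute[of _ x] ip_add_left add_mem)

lemma ip_scaleC_right: "\<lbrakk>x \<in> H; y \<in> H\<rbrakk> \<Longrightarrow> ip x (c *\<^sub>C y) = cnj c * ip x y"
  by (simp add: ip_commute[of _ x] ip_scaleC_left scaleC_mem)

lemma ip_zero_left [simp]: "x \<in> H \<Longrightarrow> ip 0 x = 0"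
  using ip_scaleC_left[of 0 x 0] zero_mem by simp

lemma ip_zero_right [simp]: "x \<in> H \<Longrightarrow> ip x 0 = 0"
  using ip_scaleC_right[of x 0 0] zero_mem by simp

lemma ip_minus_left: "\<lbrakk>x \<in> H; y \<in> H\<rbrakk> \<Longrightarrow> ip (- x) y = - ip x y"
  using ip_scaleC_left[of x y "-1"] by (simp add: scaleC_minus_one)

lemma ip_minus_right: "\<lbrakk>x \<in> H; y \<in> H\<rbrakk> \<Longrightarrow> ip x (- y) = - ip x y"
  using ip_scaleC_right[of x y "-1"] by (simp add: scaleC_minus_one)

lemma ip_diff_left: "\<lbrakk>x \<in> H; y \<in> H; z \<in> H\<rbrakk> \<Longrightarrow> ip (x - y) z = ip x z - ip y z"
  using ip_add_left[of x "- y" z] by (simp add: ip_minus_left uminus_mem)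

lemma ip_diff_right: "\<lbrakk>x \<in> H; y \<in> H; z \<in> H\<rbrakk> \<Longrightarrow> ip x (y - z) = ip x y - ip x z"
  using ip_add_right[of x y "- z"] by (simp add: ip_minus_right uminus_mem)

lemmas ip_simps = ip_add_left ip_add_right ip_diff_left ip_diff_right ip_scaleC_left
  ip_scaleC_right ip_minus_left ip_minus_right mem_intros

lemma ip_sum_left: "(\<And>i. i \<in> I \<Longrightarrow> f i \<in> H) \<Longrightarrow> y \<in> H \<Longrightarrow> ip (sum f I) y = (\<Sum>i\<in>I. ip (f i) y)"
  by (induction I rule: infinite_finite_induct) (auto simp: ip_add_left sum_mem)

lemma ip_sum_right: "(\<And>i. i \<in> I \<Longrightarrow> f i \<in> H) \<Longrightarrow> y \<in> H \<Longrightarrow> ip y (sum f I) = (\<Sum>i\<in>I. ip y (f i))"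
  by (induction I rule: infinite_finite_induct) (auto simp: ip_add_right sum_mem)

lemma Re_ip_self_nonneg: "x \<in> H \<Longrightarrow> 0 \<le> Re (ip x x)"
  using ip_pos[of x] by (cases "x = 0") (auto simp: less_imp_le)

lemma ip_self: "x \<in> H \<Longrightarrow> ip x x = of_real (\<parallel>x\<parallel>\<^sup>2)"
  using Re_ip_self_nonneg[of x] ip_commute[of x x]
  by (simp add: ip_norm_def complex_eq_iff)

lemma hnorm_sq: "x \<in> H \<Longrightarrow> \<parallel>x\<parallel>\<^sup>2 = Re (ip x x)"
  by (simp add: ip_self)

lemma hnorm_nonneg: "x \<in> H \<Longrightarrow> 0 \<le> \<parallel>x\<parallel>"
  by (simp add: ip_norm_def Re_ip_self_nonneg)

lemma hnorm_zero: "\<parallel>0\<parallel> = 0"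
  by (simp add: ip_norm_def zero_mem)

lemma hnorm_eq_0_iff: "x \<in> H \<Longrightarrow> \<parallel>x\<parallel> = 0 \<longleftrightarrow> x = 0"
  using ip_pos[of x] by (auto simp: hnorm_zero) (auto simp: ip_norm_def)

lemma hnorm_scaleC: "x \<in> H \<Longrightarrow> \<parallel>c *\<^sub>C x\<parallel> = cmod c * \<parallel>x\<parallel>"
proof -
  assume x: "x \<in> H"
  have "ip (c *\<^sub>C x) (c *\<^sub>C x) = of_real ((cmod c * \<parallel>x\<parallel>)\<^sup>2)"
    using x complex_norm_square[of c]
    by (simp add: scaleC_mem ip_scaleC_left ip_scaleC_right ip_self[OF x] power_mult_distrib
        mult.commute[of "cnj c" c] flip: mult.assoc)
  then have "\<parallel>c *\<^sub>C x\<parallel>\<^sup>2 = (cmod c * \<parallel>x\<parallel>)\<^sup>2"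
    using x by (simp add: hnorm_sq scaleC_mem)
  then show ?thesis
    using x by (simp add: hnorm_nonneg scaleC_mem)
qed

lemma hnorm_add_sq: "\<lbrakk>x \<in> H; y \<in> H\<rbrakk> \<Longrightarrow> \<parallel>x + y\<parallel>\<^sup>2 = \<parallel>x\<parallel>\<^sup>2 + 2 * Re (ip x y) + \<parallel>y\<parallel>\<^sup>2"
  by (simp add: hnorm_sq ip_simps ip_commute[of x y])

lemma hnorm_diff_sq: "\<lbrakk>x \<in> H; y \<in> H\<rbrakk> \<Longrightarrow> \<parallel>x - y\<parallel>\<^sup>2 = \<parallel>x\<parallel>\<^sup>2 - 2 * Re (ip x y) + \<parallel>y\<parallel>\<^sup>2"
  by (simp add: hnorm_sq ip_simps ip_commute[of x y])

lemma cauchy_schwarz: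
  assumes "x \<in> H" "y \<in> H"
  shows "cmod (ip x y) \<le> \<parallel>x\<parallel> * \<parallel>y\<parallel>"
proof -
  have "2 * Re (cnj c * ip x y) - (cmod c)\<^sup>2 * \<parallel>y\<parallel>\<^sup>2 \<le> \<parallel>x\<parallel>\<^sup>2" for c
    using hnorm_diff_sq[of x "c *\<^sub>C y"] zero_le_power2[of "\<parallel>x - c *\<^sub>C y\<parallel>"] assms
    by (simp add: ip_scaleC_right hnorm_scaleC scaleC_mem power_mult_distrib
        del: zero_le_power2)
  then have "(cmod (ip x y))\<^sup>2 \<le> \<parallel>x\<parallel>\<^sup>2 * \<parallel>y\<parallel>\<^sup>2"
    by (rule complex_quadratic_bound) simp
  then show ?thesis
    using assms by (metis hnorm_nonneg mult_nonneg_nonneg power2_le_imp_le power_mult_distrib)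
qed

lemma hnorm_triangle:
  assumes "x \<in> H" "y \<in> H"
  shows "\<parallel>x + y\<parallel> \<le> \<parallel>x\<parallel> + \<parallel>y\<parallel>"
proof (rule power2_le_imp_le)
  show "\<parallel>x + y\<parallel>\<^sup>2 \<le> (\<parallel>x\<parallel> + \<parallel>y\<parallel>)\<^sup>2"
    using cauchy_schwarz[OF assms] complex_Re_le_cmod[of "ip x y"] hnorm_add_sq[OF assms]
    by (simp add: power2_sum)
qed (simp add: assms hnorm_nonneg)

lemma hnorm_minus: "x \<in> H \<Longrightarrow> \<parallel>- x\<parallel> = \<parallel>x\<parallel>"
  using hnorm_scaleC[of x "-1"] by (simp add: scaleC_minus_one)

lemma hnorm_diff_commute: "\<lbrakk>x \<in> H; y \<in> H\<rbrakk> \<Longrightarrow> \<parallel>x - y\<parallel> = \<parallel>y - x\<parallel>"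
  using hnorm_minus[of "y - x"] by (simp add: diff_mem)

lemma hnorm_diff_triangle:
  "\<lbrakk>x \<in> H; y \<in> H; z \<in> H\<rbrakk> \<Longrightarrow> \<parallel>x - z\<parallel> \<le> \<parallel>x - y\<parallel> + \<parallel>y - z\<parallel>"
  using hnorm_triangle[of "x - y" "y - z"] by (simp add: diff_mem)

lemma ip_eqI:
  assumes "x \<in> H" "y \<in> H" "\<And>k. k \<in> H \<Longrightarrow> ip x k = ip y k"
  shows "x = y"
  using assms ip_pos[of "x - y"] by (auto simp: diff_mem ip_diff_left)

lemma eq_if_hnorm_diff_le_null:
  assumes "x \<in> H" "y \<in> H" "\<And>n::nat. \<parallel>x - y\<parallel> \<le> e n" "e \<longlonglongrightarrow> 0"
  shows "x = y"
proof -
  have "\<parallel>x - y\<parallel> \<le> 0"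
    using LIMSEQ_le_const[OF assms(4)] assms(3) by blast
  then have "\<parallel>x - y\<parallel> = 0"
    using hnorm_nonneg[OF diff_mem[OF assms(1,2)]] by simp
  then show ?thesis
    using hnorm_eq_0_iff[OF diff_mem[OF assms(1,2)]] by simp
qed

lemma tendsto_ip_left:
  assumes "\<And>n. X n \<in> H" "x \<in> H" "k \<in> H" "((\<lambda>n. \<parallel>X n - x\<parallel>) \<longlongrightarrow> 0) F"
  shows "((\<lambda>n. ip (X n) k) \<longlongrightarrow> ip x k) F"
proof -
  have "((\<lambda>n. ip (X n) k - ip x k) \<longlongrightarrow> 0) F"
  proof (rule Lim_null_comparison)
    show "\<forall>\<^sub>F n in F. norm (ip (X n) k - ip x k) \<le> \<parallel>X n - x\<parallel> * \<parallel>k\<parallel>"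
      using assms cauchy_schwarz[of "X _ - x" k] by (simp add: diff_mem ip_diff_left)
    show "((\<lambda>n. \<parallel>X n - x\<parallel> * \<parallel>k\<parallel>) \<longlongrightarrow> 0) F"
      using tendsto_mult_right[OF assms(4), of "\<parallel>k\<parallel>"] by simp
  qed
  then show ?thesis by (simp add: LIM_zero_iff)
qed

lemma complete_if_tail_bound:
  assumes X: "\<And>n. X n \<in> H" and e: "e \<longlonglongrightarrow> 0" and bound: "\<And>m n. n \<le> m \<Longrightarrow> \<parallel>X m - X n\<parallel> \<le> e n"
  shows "\<exists>L\<in>H. (\<lambda>n. \<parallel>X n - L\<parallel>) \<longlonglongrightarrow> 0"
proof (rule complete[OF X])
  fix d :: real assume "d > 0"
  then obtain N where N: "\<And>n. n \<ge> N \<Longrightarrow> \<bar>e n\<bar> < d"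
    using LIMSEQ_D[OF e] by auto
  have "\<parallel>X m - X n\<parallel> < d" if "m \<ge> N" "n \<ge> N" for m n
  proof (cases "n \<le> m")
    case True
    then show ?thesis using bound[of n m] N[OF that(2)] by simp
  next
    case False
    then show ?thesis
      using bound[of m n] N[OF that(1)] X by (simp add: hnorm_diff_commute[of "X m"])
  qed
  then show "\<exists>N. \<forall>m\<ge>N. \<forall>n\<ge>N. \<parallel>X m - X n\<parallel> < d" by blast
qed

section \<open>Riesz representation and adjoints\<close>

text \<open>The representing vector maximises the concave functional
  \<open>J x = 2 Re (l x) - \<parallel>x\<parallel>\<^sup>2\<close>. The parallelogram law makes a maximising sequence Cauchy,
  and comparing \<open>J (x + c k)\<close> with the supremum for all \<open>c\<close> shows that \<open>l k - \<langle>x, k\<rangle>\<close> is small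
  when \<open>J x\<close> is nearly maximal.\<close>

lemma riesz_representation:
  assumes add: "\<And>x y. \<lbrakk>x \<in> H; y \<in> H\<rbrakk> \<Longrightarrow> l (x + y) = l x + l y"
    and scale: "\<And>c x. x \<in> H \<Longrightarrow> l (c *\<^sub>C x) = cnj c * l x"
    and bound: "\<And>x. x \<in> H \<Longrightarrow> cmod (l x) \<le> M * \<parallel>x\<parallel>"
  shows "\<exists>g\<in>H. \<forall>k\<in>H. ip g k = l k"
proof -
  define J where "J x = 2 * Re (l x) - \<parallel>x\<parallel>\<^sup>2" for x
  define S where "S = (SUP x\<in>H. J x)"
  have "J x \<le> M\<^sup>2" if "x \<in> H" for x
  proof -
    have "J x \<le> 2 * (M * \<parallel>x\<parallel>) - \<parallel>x\<parallel>\<^sup>2"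
      using bound[OF that] complex_Re_le_cmod[of "l x"] by (simp add: J_def)
    then show ?thesis
      using sum_squares_ge_zero[of "M - \<parallel>x\<parallel>" 0]
      by (simp add: power2_eq_square algebra_simps)
  qed
  then have "bdd_above (J ` H)" by (rule bdd_aboveI2)
  then have J_le: "J x \<le> S" if "x \<in> H" for x
    using that unfolding S_def by (rule cSUP_upper2) simp
  have "\<exists>x\<in>H. S - 1 / real (Suc n) < J x" for n
  proof -
    have "S - 1 / real (Suc n) < (SUP x\<in>H. J x)" by (simp add: S_def)
    then show ?thesis
      using \<open>bdd_above (J ` H)\<close> zero_mem less_cSUP_iff[of H J] by blast
  qed
  then obtain X where X: "\<And>n. X n \<in> H" and J_X: "\<And>n. S - 1 / real (Suc n) < J (X n)"
    by metis
  have mid: "\<parallel>x - y\<parallel>\<^sup>2 \<le> 2 * (S - J x) + 2 * (S - J y)" if "x \<in> H" "y \<in> H" for x y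
  proof -
    have "4 * J ((1/2) *\<^sub>C (x + y)) = 2 * J x + 2 * J y + \<parallel>x - y\<parallel>\<^sup>2"
      using that
      by (simp add: J_def add scale add_mem hnorm_scaleC hnorm_add_sq
          hnorm_diff_sq power_divide)
        (simp add: field_simps)
    then show ?thesis using J_le[of "(1/2) *\<^sub>C (x + y)"] that by (simp add: mem_intros)
  qed
  have tail: "\<parallel>X m - X n\<parallel> \<le> sqrt (4 / real (Suc n))" if "n \<le> m" for m n
  proof (rule real_le_rsqrt)
    have "1 / real (Suc m) \<le> 1 / real (Suc n)"
      using that by (simp add: frac_le)
    then show "\<parallel>X m - X n\<parallel>\<^sup>2 \<le> 4 / real (Suc n)"
      using mid[OF X X, of m n] J_X[of m] J_X[of n] by simp
  qed
  have lim1: "(\<lambda>n. 1 / real (Suc n)) \<longlonglongrightarrow> 0"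
    using LIMSEQ_inverse_real_of_nat by (simp add: inverse_eq_divide)
  have "(\<lambda>n. sqrt (4 / real (Suc n))) \<longlonglongrightarrow> sqrt (4 * 0)"
    using tendsto_real_sqrt[OF tendsto_mult_left[OF lim1, of 4]] by simp
  then have "(\<lambda>n. sqrt (4 / real (Suc n))) \<longlonglongrightarrow> 0" by simp
  then obtain g where g: "g \<in> H" "(\<lambda>n. \<parallel>X n - g\<parallel>) \<longlonglongrightarrow> 0"
    using complete_if_tail_bound[of X] X tail by blast
  have "ip g k = l k" if k: "k \<in> H" for k
  proof -
    have "(cmod (l k - ip (X n) k))\<^sup>2 \<le> 1 / real (Suc n) * \<parallel>k\<parallel>\<^sup>2" for n
    proof (rule complex_quadratic_bound)
      fix c
      have "J (X n + c *\<^sub>C k) =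
          J (X n) + (2 * Re (cnj c * (l k - ip (X n) k)) - (cmod c)\<^sup>2 * \<parallel>k\<parallel>\<^sup>2)"
        using X k by (simp add: J_def add scale scaleC_mem hnorm_add_sq hnorm_scaleC
            ip_scaleC_right power_mult_distrib algebra_simps)
      then show "2 * Re (cnj c * (l k - ip (X n) k)) - (cmod c)\<^sup>2 * \<parallel>k\<parallel>\<^sup>2 \<le> 1 / real (Suc n)"
        using J_le[of "X n + c *\<^sub>C k"] J_X[of n] X k by (simp add: mem_intros)
    qed simp
    moreover have "(\<lambda>n. 1 / real (Suc n) * \<parallel>k\<parallel>\<^sup>2) \<longlonglongrightarrow> 0"
      using tendsto_mult_right[OF lim1, of "\<parallel>k\<parallel>\<^sup>2"] by simp
    moreover have "(\<lambda>n. (cmod (l k - ip (X n) k))\<^sup>2) \<longlonglongrightarrow> (cmod (l k - ip g k))\<^sup>2"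
      by (intro tendsto_intros tendsto_ip_left X g k)
    ultimately have "(cmod (l k - ip g k))\<^sup>2 \<le> 0"
      using LIMSEQ_le[of _ _ _ 0] by blast
    then show ?thesis by simp
  qed
  then show ?thesis using g(1) by blast
qed

lemma contraction_mem: "contraction_in H ip A \<Longrightarrow> x \<in> H \<Longrightarrow> A x \<in> H"
  and contraction_le: "contraction_in H ip A \<Longrightarrow> x \<in> H \<Longrightarrow> \<parallel>A x\<parallel> \<le> \<parallel>x\<parallel>"
  and contraction_add: "contraction_in H ip A \<Longrightarrow> x \<in> H \<Longrightarrow> y \<in> H \<Longrightarrow> A (x + y) = A x + A y"
  and contraction_scaleC: "contraction_in H ip A \<Longrightarrow> x \<in> H \<Longrightarrow> A (c *\<^sub>C x) = c *\<^sub>C A x"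
  by (simp_all add: contraction_in_def)

lemma contraction_diff:
  assumes "contraction_in H ip A" "x \<in> H" "y \<in> H"
  shows "A (x - y) = A x - A y"
  using contraction_add[OF assms(1), of x "- y"] contraction_scaleC[OF assms(1,3), of "-1"] assms
  by (simp add: scaleC_minus_one uminus_mem)

text \<open>The definite description in \<open>hilbert_adjoint\<close> is met by Riesz representation, as
  \<open>k \<mapsto> \<langle>h, A k\<rangle>\<close> is bounded.\<close>

lemma
  assumes A: "contraction_in H ip A" and h: "h \<in> H"
  shows hilbert_adjoint_mem: "hilbert_adjoint H ip A h \<in> H"
    and ip_hilbert_adjoint: "k \<in> H \<Longrightarrow> ip (hilbert_adjoint H ip A h) k = ip h (A k)"
proof -
  note A_simps = contraction_mem[OF A] contraction_add[OF A] contraction_scaleC[OF A]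
  have "cmod (ip h (A x)) \<le> \<parallel>h\<parallel> * \<parallel>x\<parallel>" if "x \<in> H" for x
    using cauchy_schwarz[OF h contraction_mem[OF A that]] contraction_le[OF A that]
      mult_left_mono[OF _ hnorm_nonneg[OF h]] by (meson order_trans)
  then have ex: "\<exists>g\<in>H. \<forall>k\<in>H. ip g k = ip h (A k)"
    using h by (intro riesz_representation[where M = "\<parallel>h\<parallel>"]) (simp_all add: A_simps ip_simps)
  then have "\<exists>!g. g \<in> H \<and> (\<forall>k\<in>H. ip g k = ip h (A k))"
    by (auto intro: ip_eqI)
  from theI'[OF this, folded hilbert_adjoint_def]
  show "hilbert_adjoint H ip A h \<in> H"
    and "k \<in> H \<Longrightarrow> ip (hilbert_adjoint H ip A h) k = ip h (A k)" by auto
qed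

text \<open>The norm bound follows from \<open>\<parallel>A\<^sup>* x\<parallel>\<^sup>2 = \<langle>x, A A\<^sup>* x\<rangle>\<close>.\<close>

lemma contraction_hilbert_adjoint:
  assumes A: "contraction_in H ip A"
  shows "contraction_in H ip (hilbert_adjoint H ip A)"
  unfolding contraction_in_def
proof (intro conjI ballI allI)
  note [simp] = hilbert_adjoint_mem[OF A] ip_hilbert_adjoint[OF A] contraction_mem[OF A]
    contraction_add[OF A] contraction_scaleC[OF A] ip_simps
  let ?B = "hilbert_adjoint H ip A"
  show "?B x \<in> H" if "x \<in> H" for x
    using that by simp
  show "\<parallel>?B x\<parallel> \<le> \<parallel>x\<parallel>" if x: "x \<in> H" for x
  proof -
    have "\<parallel>?B x\<parallel>\<^sup>2 = Re (ip x (A (?B x)))" using x by (simp add: hnorm_sq)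
    also have "\<dots> \<le> \<parallel>x\<parallel> * \<parallel>A (?B x)\<parallel>"
      using cauchy_schwarz[of x "A (?B x)"] complex_Re_le_cmod[of "ip x (A (?B x))"] x by simp
    also have "\<dots> \<le> \<parallel>x\<parallel> * \<parallel>?B x\<parallel>"
      using x by (intro mult_left_mono contraction_le[OF A] hnorm_nonneg) simp_all
    finally have "\<parallel>?B x\<parallel> * \<parallel>?B x\<parallel> \<le> \<parallel>x\<parallel> * \<parallel>?B x\<parallel>" by (simp add: power2_eq_square)
    then show ?thesis
      using hnorm_nonneg[of "?B x"] hnorm_nonneg[OF x] x
      by (cases "\<parallel>?B x\<parallel> = 0") (auto simp: mult_le_cancel_right)
  qed
  show "?B (x + y) = ?B x + ?B y" if "x \<in> H" "y \<in> H" for x y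
    using that by (intro ip_eqI) simp_all
  show "?B (c *\<^sub>C x) = c *\<^sub>C ?B x" if "x \<in> H" for c x
    using that by (intro ip_eqI) simp_all
qed

lemma bounded_op_mem: "bounded_op_into H ip C \<Longrightarrow> C b \<in> H"
  and bounded_op_add: "bounded_op_into H ip C \<Longrightarrow> C (b + c) = C b + C c"
  and bounded_op_scaleC: "bounded_op_into H ip C \<Longrightarrow> C (a *\<^sub>C b) = a *\<^sub>C C b"
  by (simp_all add: bounded_op_into_def)

lemma bounded_op_bound:
  assumes "bounded_op_into H ip C"
  obtains M where "0 \<le> M" "\<And>b. \<parallel>C b\<parallel> \<le> M * norm b"
proof -
  obtain M where M: "\<And>b. \<parallel>C b\<parallel> \<le> M * norm b"
    using assms by (auto simp: bounded_op_into_def)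
  have "\<parallel>C b\<parallel> \<le> \<bar>M\<bar> * norm b" for b
    using M[of b] mult_right_mono[OF abs_ge_self[of M] norm_ge_zero[of b]] by linarith
  then show ?thesis using that[of "\<bar>M\<bar>"] by simp
qed

lemma adjoint_to_cdual_apply:
  assumes C: "bounded_op_into H ip C" and h: "h \<in> H"
  shows "\<langle>adjoint_to_cdual ip C h, b\<rangle> = ip h (C b)"
proof -
  obtain M where M: "\<And>b. \<parallel>C b\<parallel> \<le> M * norm b"
    using bounded_op_bound[OF C] by blast
  note C_simps = bounded_op_mem[OF C] bounded_op_add[OF C] bounded_op_scaleC[OF C]
  have "\<exists>f. \<forall>b. \<langle>f, b\<rangle> = ip h (C b)"
  proof (rule ex_cdual[where K = "\<parallel>h\<parallel> * M"])
    show "cmod (ip h (C b)) \<le> \<parallel>h\<parallel> * M * norm b" for b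
      using cauchy_schwarz[OF h, of "C b"] mult_left_mono[OF M hnorm_nonneg[OF h], of b]
      by (simp add: C_simps mult_ac)
  qed (use h in \<open>simp_all add: C_simps ip_simps\<close>)
  then have "\<exists>!f. \<forall>b. \<langle>f, b\<rangle> = ip h (C b)"
    by (auto intro: cdual_eqI)
  from theI'[OF this, folded adjoint_to_cdual_def] show ?thesis by blast
qed

section \<open>Resolvents of contractions\<close>

text \<open>The solution of \<open>x - c A x = y\<close> is the limit of the iteration \<open>x \<mapsto> y + c A x\<close>
  started at \<open>0\<close>. The iterates are bounded by \<open>\<parallel>y\<parallel> / (1 - |c|)\<close>, and
  \<open>X (k + n) - X n\<close> is the \<open>n\<close>-th power of \<open>c A\<close> applied to \<open>X k\<close>.\<close>

lemma resolvent_exists: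
  assumes A: "contraction_in H ip A" and c: "cmod c < 1" and y: "y \<in> H"
  shows "\<exists>x\<in>H. x - c *\<^sub>C A x = y"
proof -
  define X where "X = rec_nat 0 (\<lambda>_ x. y + c *\<^sub>C A x)"
  define B where "B = \<parallel>y\<parallel> / (1 - cmod c)"
  have X_0: "X 0 = 0" and X_Suc: "X (Suc n) = y + c *\<^sub>C A (X n)" for n
    by (simp_all add: X_def)
  note A_mem = contraction_mem[OF A]
  have X: "X n \<in> H" for n
    by (induction n) (simp_all add: X_0 X_Suc y mem_intros A_mem)
  have cA: "\<parallel>c *\<^sub>C A x\<parallel> \<le> cmod c * \<parallel>x\<parallel>" if "x \<in> H" for x
    using that contraction_le[OF A that] by (simp add: hnorm_scaleC A_mem mult_left_mono)
  have B: "\<parallel>y\<parallel> + cmod c * B = B"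
    using c by (simp add: B_def field_simps)
  have "0 \<le> B" using c y by (simp add: B_def hnorm_nonneg)
  have X_le: "\<parallel>X k\<parallel> \<le> B" for k
  proof (induction k)
    case 0
    then show ?case using \<open>0 \<le> B\<close> by (simp add: X_0 hnorm_zero)
  next
    case (Suc k)
    have "\<parallel>X (Suc k)\<parallel> \<le> \<parallel>y\<parallel> + cmod c * \<parallel>X k\<parallel>"
      using hnorm_triangle[OF y, of "c *\<^sub>C A (X k)"] cA[OF X[of k]] X y
      by (simp add: X_Suc mem_intros A_mem)
    also have "\<dots> \<le> \<parallel>y\<parallel> + cmod c * B" using Suc by (simp add: mult_left_mono)
    finally show ?case by (simp add: B)
  qed
  have diff: "\<parallel>X (n + k) - X n\<parallel> \<le> cmod c ^ n * B" for n k
  proof (induction n)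
    case 0
    then show ?case using X_le by (simp add: X_0)
  next
    case (Suc n)
    have "X (Suc n + k) - X (Suc n) = c *\<^sub>C A (X (n + k) - X n)"
      using X by (simp add: X_Suc contraction_diff[OF A] scaleC_diff_right)
    then have "\<parallel>X (Suc n + k) - X (Suc n)\<parallel> \<le> cmod c * \<parallel>X (n + k) - X n\<parallel>"
      using cA X by (simp add: diff_mem)
    also have "\<dots> \<le> cmod c * (cmod c ^ n * B)" using Suc by (simp add: mult_left_mono)
    finally show ?case by (simp add: mult_ac)
  qed
  have e: "(\<lambda>n. cmod c ^ n * B) \<longlonglongrightarrow> 0"
    using tendsto_mult_right[OF LIMSEQ_power_zero[of "cmod c"], of B] c by simp
  have "\<exists>L\<in>H. (\<lambda>n. \<parallel>X n - L\<parallel>) \<longlonglongrightarrow> 0"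
  proof (rule complete_if_tail_bound[OF X e])
    show "\<parallel>X m - X n\<parallel> \<le> cmod c ^ n * B" if "n \<le> m" for m n
      using diff[of n "m - n"] that by simp
  qed
  then obtain L where L: "L \<in> H" and lim: "(\<lambda>n. \<parallel>X n - L\<parallel>) \<longlonglongrightarrow> 0" by blast
  have "L - c *\<^sub>C A L = y"
  proof (rule eq_if_hnorm_diff_le_null)
    fix n
    have eq: "L - c *\<^sub>C A L - y = - (X (Suc n) - L) + c *\<^sub>C A (X n - L)"
      using X L by (simp add: X_Suc contraction_diff[OF A] scaleC_diff_right)
    have "\<parallel>L - c *\<^sub>C A L - y\<parallel> \<le> \<parallel>- (X (Suc n) - L)\<parallel> + \<parallel>c *\<^sub>C A (X n - L)\<parallel>"
      unfolding eq by (rule hnorm_triangle) (use X L in \<open>simp_all add: mem_intros A_mem\<close>)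
    also have "\<dots> \<le> \<parallel>X (Suc n) - L\<parallel> + cmod c * \<parallel>X n - L\<parallel>"
      using cA[of "X n - L"] X L hnorm_minus[of "X (Suc n) - L"]
      by (simp del: minus_diff_eq add: mem_intros)
    finally show "\<parallel>L - c *\<^sub>C A L - y\<parallel> \<le> \<parallel>X (Suc n) - L\<parallel> + cmod c * \<parallel>X n - L\<parallel>" .
  next
    show "(\<lambda>n. \<parallel>X (Suc n) - L\<parallel> + cmod c * \<parallel>X n - L\<parallel>) \<longlonglongrightarrow> 0"
      using tendsto_add[OF LIMSEQ_Suc[OF lim] tendsto_mult_left[OF lim, of "cmod c"]] by simp
  qed (simp_all add: L y A_mem mem_intros)
  with L show ?thesis by blast
qed

definition resolvent :: "('h \<Rightarrow> 'h) \<Rightarrow> complex \<Rightarrow> 'h \<Rightarrow> 'h"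
  where "resolvent A c = inv_into H (\<lambda>h. h - c *\<^sub>C A h)"

context
  fixes A :: "'h \<Rightarrow> 'h" and c :: complex
  assumes A: "contraction_in H ip A" and c: "cmod c < 1"
begin

lemma resolvent_mem: "y \<in> H \<Longrightarrow> resolvent A c y \<in> H"
  and resolvent_solves: "y \<in> H \<Longrightarrow> resolvent A c y - c *\<^sub>C A (resolvent A c y) = y"
  using resolvent_exists[OF A c, of y]
    inv_into_into[of y "\<lambda>h. h - c *\<^sub>C A h" H] f_inv_into_f[of y "\<lambda>h. h - c *\<^sub>C A h" H]
  by (auto simp: resolvent_def image_iff)

lemma hnorm_le_resolvent_equation:
  assumes "x \<in> H"
  shows "\<parallel>x\<parallel> \<le> \<parallel>x - c *\<^sub>C A x\<parallel> / (1 - cmod c)"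
proof -
  have "\<parallel>x\<parallel> \<le> \<parallel>x - c *\<^sub>C A x\<parallel> + \<parallel>c *\<^sub>C A x\<parallel>"
    using hnorm_triangle[of "x - c *\<^sub>C A x" "c *\<^sub>C A x"] assms contraction_mem[OF A assms]
    by (simp add: mem_intros)
  also have "\<parallel>c *\<^sub>C A x\<parallel> \<le> cmod c * \<parallel>x\<parallel>"
    using contraction_mem[OF A assms] contraction_le[OF A assms]
    by (simp add: hnorm_scaleC mult_left_mono)
  finally have "\<parallel>x\<parallel> * (1 - cmod c) \<le> \<parallel>x - c *\<^sub>C A x\<parallel>" by (simp add: algebra_simps)
  then show ?thesis using c by (simp add: pos_le_divide_eq)
qed

lemma resolvent_eqI:
  assumes x: "x \<in> H" and eq: "x - c *\<^sub>C A x = y"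
  shows "resolvent A c y = x"
proof -
  have y: "y \<in> H" using assms contraction_mem[OF A x] by (auto intro: mem_intros)
  let ?r = "resolvent A c y"
  have "(?r - x) - c *\<^sub>C A (?r - x) = (?r - c *\<^sub>C A ?r) - (x - c *\<^sub>C A x)"
    using resolvent_mem[OF y] x by (simp add: contraction_diff[OF A] scaleC_diff_right)
  also have "\<dots> = 0"
    using resolvent_solves[OF y] eq by simp
  finally have "\<parallel>?r - x\<parallel> \<le> 0"
    using hnorm_le_resolvent_equation[of "?r - x"] resolvent_mem[OF y] x
    by (simp add: diff_mem hnorm_zero)
  then show ?thesis
    using hnorm_eq_0_iff[of "?r - x"] hnorm_nonneg[of "?r - x"] resolvent_mem[OF y] x
    by (simp add: diff_mem)
qed

lemma hnorm_resolvent_le: "y \<in> H \<Longrightarrow> \<parallel>resolvent A c y\<parallel> \<le> \<parallel>y\<parallel> / (1 - cmod c)"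
  using hnorm_le_resolvent_equation[OF resolvent_mem] resolvent_solves by fastforce

lemma resolvent_add:
  assumes x: "x \<in> H" and y: "y \<in> H"
  shows "resolvent A c (x + y) = resolvent A c x + resolvent A c y"
proof (rule resolvent_eqI)
  let ?r = "resolvent A c"
  have "?r x + ?r y - c *\<^sub>C A (?r x + ?r y) = (?r x - c *\<^sub>C A (?r x)) + (?r y - c *\<^sub>C A (?r y))"
    using x y by (simp add: resolvent_mem contraction_add[OF A] scaleC_add_right)
  then show "?r x + ?r y - c *\<^sub>C A (?r x + ?r y) = x + y"
    using x y by (simp add: resolvent_solves)
qed (use x y in \<open>simp add: add_mem resolvent_mem\<close>)

lemma resolvent_scaleC:
  assumes x: "x \<in> H"
  shows "resolvent A c (a *\<^sub>C x) = a *\<^sub>C resolvent A c x"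
proof (rule resolvent_eqI)
  let ?r = "resolvent A c"
  have "a *\<^sub>C ?r x - c *\<^sub>C A (a *\<^sub>C ?r x) = a *\<^sub>C (?r x - c *\<^sub>C A (?r x))"
    using x by (simp add: resolvent_mem contraction_scaleC[OF A] scaleC_diff_right scaleC_scaleC
        mult.commute)
  then show "a *\<^sub>C ?r x - c *\<^sub>C A (a *\<^sub>C ?r x) = a *\<^sub>C x"
    using x by (simp add: resolvent_solves)
qed (use x in \<open>simp add: scaleC_mem resolvent_mem\<close>)

text \<open>Since \<open>I - c A\<close> commutes with \<open>I + c A = 2 I - (I - c A)\<close>, the Cayley transform can be
  written with either order of its two factors.\<close>

lemma resolvent_cayley:
  assumes "x \<in> H"
  shows "resolvent A c (x + c *\<^sub>C A x) = resolvent A c x + c *\<^sub>C A (resolvent A c x)"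
    and "resolvent A c x + c *\<^sub>C A (resolvent A c x) = 2 *\<^sub>C resolvent A c x - x"
proof -
  let ?r = "resolvent A c x"
  have r: "?r \<in> H" "A ?r \<in> H" and eq: "c *\<^sub>C A ?r = ?r - x"
    using resolvent_mem[OF assms] resolvent_solves[OF assms] contraction_mem[OF A]
    by (auto simp: algebra_simps)
  have "A x = A (?r - c *\<^sub>C A ?r)" using resolvent_solves[OF assms] by simp
  then have "A x = A ?r - c *\<^sub>C A (A ?r)"
    using r by (simp add: contraction_diff[OF A] contraction_scaleC[OF A] scaleC_mem)
  then have "c *\<^sub>C A x = c *\<^sub>C A ?r - c *\<^sub>C c *\<^sub>C A (A ?r)"
    by (simp add: scaleC_diff_right)
  then show "resolvent A c (x + c *\<^sub>C A x) = ?r + c *\<^sub>C A ?r"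
    using r eq
    by (intro resolvent_eqI)
      (simp_all add: mem_intros contraction_add[OF A] contraction_scaleC[OF A] scaleC_add_right
        algebra_simps)
  show "?r + c *\<^sub>C A ?r = 2 *\<^sub>C ?r - x"
    using eq scaleC_add_left[of 1 1 ?r] by (simp add: scaleC_one)
qed

end

lemma resolvent_identity:
  assumes A: "contraction_in H ip A" and "cmod c < 1" "cmod d < 1" and y: "y \<in> H"
  shows "resolvent A c y - resolvent A d y = (c - d) *\<^sub>C resolvent A c (A (resolvent A d y))"
proof -
  let ?r = "resolvent A d y"
  note mem = resolvent_mem[OF A assms(3) y] contraction_mem[OF A resolvent_mem[OF A assms(3) y]]
  have "resolvent A c y = ?r + (c - d) *\<^sub>C resolvent A c (A ?r)"
  proof (rule resolvent_eqI[OF A assms(2)])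
    show "?r + (c - d) *\<^sub>C resolvent A c (A ?r) \<in> H"
      using mem by (simp add: mem_intros resolvent_mem[OF A assms(2)])
    have "?r + (c - d) *\<^sub>C resolvent A c (A ?r) - c *\<^sub>C A (?r + (c - d) *\<^sub>C resolvent A c (A ?r))
      = ?r - c *\<^sub>C A ?r + (c - d) *\<^sub>C (resolvent A c (A ?r) - c *\<^sub>C A (resolvent A c (A ?r)))"
      using mem by (simp add: contraction_add[OF A] contraction_scaleC[OF A] mem_intros
          resolvent_mem[OF A assms(2)] scaleC_add_right scaleC_diff_right scaleC_scaleC mult.commute)
    also have "\<dots> = ?r - d *\<^sub>C A ?r"
      using mem by (simp add: resolvent_solves[OF A assms(2)] scaleC_diff_left)
    finally show "?r + (c - d) *\<^sub>C resolvent A c (A ?r) -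
        c *\<^sub>C A (?r + (c - d) *\<^sub>C resolvent A c (A ?r)) = y"
      using resolvent_solves[OF A assms(3) y] by simp
  qed
  then show ?thesis by simp
qed

end

section \<open>Holomorphic vector-valued functions\<close>

lemma bounded_linear_scaleC_left: "bounded_linear (\<lambda>h. h *\<^sub>C (v::'a::complex_normed_vector))"
  by (rule bounded_linear_intro[where K = "norm v"])
    (simp_all add: scaleC_add_left norm_scaleC scaleR_scaleC scaleC_scaleC scaleC_complex_def)

lemma vector_holomorphic_onI:
  fixes f :: "complex \<Rightarrow> 'a::complex_normed_vector"
  assumes "\<And>w. w \<in> S \<Longrightarrow> \<exists>v K. \<exists>d>0. \<forall>z\<in>S. cmod (z - w) < d \<longrightarrow>
    norm (f z - f w - (z - w) *\<^sub>C v) \<le> K * (cmod (z - w))\<^sup>2"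
  shows "vector_holomorphic_on f S"
  unfolding vector_holomorphic_on_def
proof
  fix w assume "w \<in> S"
  then obtain v K d where d: "d > 0" and bound: "\<And>z. z \<in> S \<Longrightarrow> cmod (z - w) < d \<Longrightarrow>
      norm (f z - f w - (z - w) *\<^sub>C v) \<le> K * (cmod (z - w))\<^sup>2"
    using assms by metis
  have "((\<lambda>z. norm (f z - f w - (z - w) *\<^sub>C v) / norm (z - w)) \<longlongrightarrow> 0) (at w within S)"
  proof (rule Lim_null_comparison)
    have "norm (norm (f z - f w - (z - w) *\<^sub>C v) / norm (z - w)) \<le> K * cmod (z - w)"
      if "z \<in> S" "z \<noteq> w" "dist z w < d" for z
      using bound[OF that(1)] that(2,3)
      by (simp add: dist_norm divide_le_eq power2_eq_square mult_ac)
    then show "\<forall>\<^sub>F z in at w within S.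
        norm (norm (f z - f w - (z - w) *\<^sub>C v) / norm (z - w)) \<le> K * cmod (z - w)"
      using d by (auto simp: eventually_at)
    have "((\<lambda>z. K * cmod (z - w)) \<longlongrightarrow> K * cmod (w - w)) (at w within S)"
      by (intro tendsto_intros)
    then show "((\<lambda>z. K * cmod (z - w)) \<longlongrightarrow> 0) (at w within S)" by simp
  qed
  then show "\<exists>f'. (f has_derivative (\<lambda>h. h *\<^sub>C f')) (at w within S)"
    using bounded_linear_scaleC_left[of v] by (auto simp: has_derivative_iff_norm)
qed

lemma vector_holomorphic_on_affine:
  fixes f :: "complex \<Rightarrow> 'a::complex_normed_vector"
  assumes "vector_holomorphic_on f S"
  shows "vector_holomorphic_on (\<lambda>z. a + c *\<^sub>C f z) S"
  unfolding vector_holomorphic_on_def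
proof
  fix w assume "w \<in> S"
  then obtain v where "(f has_derivative (\<lambda>h. h *\<^sub>C v)) (at w within S)"
    using assms by (auto simp: vector_holomorphic_on_def)
  from has_derivative_add[OF has_derivative_const[of a]
      bounded_linear.has_derivative[OF bounded_linear_scaleC_right[of c] this]]
  have "((\<lambda>z. a + c *\<^sub>C f z) has_derivative (\<lambda>h. h *\<^sub>C (c *\<^sub>C v))) (at w within S)"
    by (simp add: scaleC_scaleC mult.commute)
  then show "\<exists>f'. ((\<lambda>z. a + c *\<^sub>C f z) has_derivative (\<lambda>h. h *\<^sub>C f')) (at w within S)" by blast
qed

context complex_hilbert_space
begin

text \<open>Applying the resolvent identity twice turns the remainder of the first-order expansion into
  \<open>(z - w)\<^sup>2 R(z) A R(w) A R(w) x\<close>, where \<open>R(z) = (I - z A)\<^sup>-\<^sup>1\<close> has norm at most \<open>1 / (1 - |z|)\<close>.\<close>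

lemma resolvent_remainder:
  assumes A: "contraction_in H ip A" and z: "cmod z < 1" and w: "cmod w < 1" and x: "x \<in> H"
  shows "\<parallel>resolvent A z x - resolvent A w x - (z - w) *\<^sub>C resolvent A w (A (resolvent A w x))\<parallel>
    \<le> (cmod (z - w))\<^sup>2 * (\<parallel>x\<parallel> / (1 - cmod w) / (1 - cmod w) / (1 - cmod z))"
proof -
  let ?y = "A (resolvent A w x)"
  let ?t = "A (resolvent A w ?y)"
  have y: "?y \<in> H" and t: "?t \<in> H"
    using resolvent_mem[OF A w] contraction_mem[OF A] x by auto
  have A_res_le: "\<parallel>A (resolvent A w u)\<parallel> \<le> \<parallel>u\<parallel> / (1 - cmod w)" if "u \<in> H" for u
    using contraction_le[OF A resolvent_mem[OF A w that]] hnorm_resolvent_le[OF A w that]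
    by simp
  have "resolvent A z x - resolvent A w x - (z - w) *\<^sub>C resolvent A w ?y
      = (z - w) *\<^sub>C (resolvent A z ?y - resolvent A w ?y)"
    by (simp add: resolvent_identity[OF A z w x] scaleC_diff_right)
  also have "\<dots> = (z - w)\<^sup>2 *\<^sub>C resolvent A z ?t"
    by (simp add: resolvent_identity[OF A z w y] scaleC_scaleC power2_eq_square)
  finally have "\<parallel>resolvent A z x - resolvent A w x - (z - w) *\<^sub>C resolvent A w ?y\<parallel>
      = (cmod (z - w))\<^sup>2 * \<parallel>resolvent A z ?t\<parallel>"
    using t by (simp add: hnorm_scaleC resolvent_mem[OF A z] norm_power)
  also have "\<parallel>resolvent A z ?t\<parallel> \<le> \<parallel>x\<parallel> / (1 - cmod w) / (1 - cmod w) / (1 - cmod z)"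
  proof -
    have "\<parallel>?t\<parallel> \<le> \<parallel>?y\<parallel> / (1 - cmod w)" by (rule A_res_le[OF y])
    also have "\<dots> \<le> \<parallel>x\<parallel> / (1 - cmod w) / (1 - cmod w)"
      using A_res_le[OF x] w by (intro divide_right_mono) auto
    finally have "\<parallel>?t\<parallel> / (1 - cmod z) \<le> \<parallel>x\<parallel> / (1 - cmod w) / (1 - cmod w) / (1 - cmod z)"
      using z by (intro divide_right_mono) auto
    then show ?thesis using hnorm_resolvent_le[OF A z t] by linarith
  qed
  finally show ?thesis by (simp add: mult_left_mono)
qed

text \<open>The function \<open>\<Theta>(z) = C\<^sup>* (I - z A)\<^sup>-\<^sup>1 C\<close> is analytic with derivative
  \<open>C\<^sup>* (I - w A)\<^sup>-\<^sup>1 A (I - w A)\<^sup>-\<^sup>1 C\<close> at \<open>w\<close>. The radius \<open>\<delta>\<close> in the proof is chosen so that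
  \<open>1 - |z| \<ge> \<delta>\<close> for \<open>|z - w| < \<delta>\<close>, which makes the bound of \<open>resolvent_remainder\<close> uniform.\<close>

lemma holomorphic_compressed_resolvent:
  fixes C :: "'b::complex_normed_vector \<Rightarrow> 'h"
  assumes A: "contraction_in H ip A" and C: "bounded_op_into H ip C"
  shows "\<exists>\<Theta> :: complex \<Rightarrow> ('b, 'b cdual) cblinfun.
    (\<forall>z\<in>ball 0 1. \<forall>b c. \<langle>\<Theta> z *\<^sub>V b, c\<rangle> = ip (resolvent A z (C b)) (C c)) \<and>
    vector_holomorphic_on \<Theta> (ball 0 1)"
proof -
  obtain M where "0 \<le> M" and M: "\<And>b. \<parallel>C b\<parallel> \<le> M * norm b"
    using bounded_op_bound[OF C] by blast
  have C_mem [simp]: "C b \<in> H" for b by (rule bounded_op_mem[OF C])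
  note C_simps = bounded_op_add[OF C] bounded_op_scaleC[OF C]
  have op_ex: "\<exists>T :: ('b, 'b cdual) cblinfun. \<forall>b c. \<langle>T *\<^sub>V b, c\<rangle> = ip (B (C b)) (C c)"
    if B: "\<And>x. x \<in> H \<Longrightarrow> B x \<in> H" "\<And>x y. x \<in> H \<Longrightarrow> y \<in> H \<Longrightarrow> B (x + y) = B x + B y"
      "\<And>a x. x \<in> H \<Longrightarrow> B (a *\<^sub>C x) = a *\<^sub>C B x" "\<And>x. x \<in> H \<Longrightarrow> \<parallel>B x\<parallel> \<le> K * \<parallel>x\<parallel>" "0 \<le> K" for B K
  proof (rule ex_cblinfun_of_sesquilinear[where K = "K * M * M"])
    show "cmod (ip (B (C b)) (C c)) \<le> K * M * M * norm b * norm c" for b c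
    proof -
      have "cmod (ip (B (C b)) (C c)) \<le> \<parallel>B (C b)\<parallel> * \<parallel>C c\<parallel>"
        by (rule cauchy_schwarz) (simp_all add: B)
      also have "\<dots> \<le> (K * (M * norm b)) * (M * norm c)"
        using B(4)[of "C b"] mult_left_mono[OF M B(5)] \<open>0 \<le> M\<close> \<open>0 \<le> K\<close>
        by (intro mult_mono M) (auto intro: order_trans hnorm_nonneg)
      finally show ?thesis by (simp add: mult_ac)
    qed
  qed (use \<open>0 \<le> M\<close> \<open>0 \<le> K\<close> in \<open>simp_all add: C_simps B ip_simps\<close>)
  have "\<exists>T :: ('b, 'b cdual) cblinfun. \<forall>b c. \<langle>T *\<^sub>V b, c\<rangle> = ip (resolvent A z (C b)) (C c)"
    if "cmod z < 1" for z
    by (rule op_ex[where K = "1 / (1 - cmod z)"])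
      (use that in \<open>auto simp: resolvent_mem[OF A] resolvent_add[OF A] resolvent_scaleC[OF A]
        hnorm_resolvent_le[OF A]\<close>)
  then obtain \<Theta> :: "complex \<Rightarrow> ('b, 'b cdual) cblinfun"
    where \<Theta>: "\<And>z b c. cmod z < 1 \<Longrightarrow> \<langle>\<Theta> z *\<^sub>V b, c\<rangle> = ip (resolvent A z (C b)) (C c)"
    by metis
  have "vector_holomorphic_on \<Theta> (ball 0 1)"
  proof (rule vector_holomorphic_onI)
    fix w :: complex assume "w \<in> ball 0 1"
    then have w: "cmod w < 1" by simp
    define \<delta> where "\<delta> = (1 - cmod w) / 2"
    have \<delta>: "0 < \<delta>" and \<delta>_le: "\<delta> \<le> 1 - cmod w" using w by (simp_all add: \<delta>_def)
    let ?R' = "\<lambda>x. resolvent A w (A (resolvent A w x))"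
    have R'_mem: "?R' x \<in> H" if "x \<in> H" for x
      using that by (simp add: resolvent_mem[OF A w] contraction_mem[OF A])
    have res_\<delta>: "\<parallel>resolvent A w x\<parallel> \<le> \<parallel>x\<parallel> / \<delta>" if "x \<in> H" for x
    proof -
      have "\<parallel>x\<parallel> / (1 - cmod w) \<le> \<parallel>x\<parallel> / \<delta>"
        using \<delta> \<delta>_le that by (intro divide_left_mono) (auto simp: hnorm_nonneg)
      then show ?thesis using hnorm_resolvent_le[OF A w that] by simp
    qed
    have "\<exists>T :: ('b, 'b cdual) cblinfun. \<forall>b c. \<langle>T *\<^sub>V b, c\<rangle> = ip (?R' (C b)) (C c)"
    proof (rule op_ex[where K = "1 / \<delta> / \<delta>"])
      show "\<parallel>?R' x\<parallel> \<le> 1 / \<delta> / \<delta> * \<parallel>x\<parallel>" if "x \<in> H" for x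
      proof -
        have "\<parallel>?R' x\<parallel> \<le> \<parallel>A (resolvent A w x)\<parallel> / \<delta>"
          using that by (intro res_\<delta>) (simp add: resolvent_mem[OF A w] contraction_mem[OF A])
        also have "\<dots> \<le> \<parallel>x\<parallel> / \<delta> / \<delta>"
          using contraction_le[OF A resolvent_mem[OF A w that]] res_\<delta>[OF that] \<delta>
          by (intro divide_right_mono) auto
        finally show ?thesis by simp
      qed
    qed (use \<delta> in \<open>simp_all add: R'_mem resolvent_mem[OF A w] contraction_mem[OF A]
        resolvent_add[OF A w] resolvent_scaleC[OF A w] contraction_add[OF A] contraction_scaleC[OF A]\<close>)
    then obtain T :: "('b, 'b cdual) cblinfun"
      where T: "\<And>b c. \<langle>T *\<^sub>V b, c\<rangle> = ip (?R' (C b)) (C c)" by blast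
    have "norm (\<Theta> z - \<Theta> w - (z - w) *\<^sub>C T) \<le> M * M / \<delta> / \<delta> / \<delta> * (cmod (z - w))\<^sup>2"
      if z: "cmod z < 1" and zw: "cmod (z - w) < \<delta>" for z
    proof (rule norm_cblinfun_cdual_le)
      fix b c
      let ?r = "resolvent A z (C b) - resolvent A w (C b) - (z - w) *\<^sub>C ?R' (C b)"
      have r_mem: "?r \<in> H"
        by (simp add: mem_intros R'_mem resolvent_mem[OF A w] resolvent_mem[OF A z])
      have "\<delta> \<le> 1 - cmod z"
        using zw norm_triangle_ineq2[of z w] by (simp add: \<delta>_def)
      have "\<parallel>C b\<parallel> / (1 - cmod w) / (1 - cmod w) / (1 - cmod z) \<le> M * norm b / \<delta> / \<delta> / \<delta>"
        using \<delta> \<delta>_le \<open>\<delta> \<le> 1 - cmod z\<close> \<open>0 \<le> M\<close>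
        by (intro frac_le M) (auto intro!: divide_nonneg_pos mult_nonneg_nonneg)
      then have "(cmod (z - w))\<^sup>2 * (\<parallel>C b\<parallel> / (1 - cmod w) / (1 - cmod w) / (1 - cmod z))
          \<le> (cmod (z - w))\<^sup>2 * (M * norm b / \<delta> / \<delta> / \<delta>)"
        by (rule mult_left_mono) simp
      then have r_le: "\<parallel>?r\<parallel> \<le> (cmod (z - w))\<^sup>2 * (M * norm b / \<delta> / \<delta> / \<delta>)"
        using resolvent_remainder[OF A z w C_mem[of b]] by linarith
      have "\<langle>(\<Theta> z - \<Theta> w - (z - w) *\<^sub>C T) *\<^sub>V b, c\<rangle> = ip ?r (C c)"
        by (simp add: cblinfun_rep_eq cdual_rep_eq \<Theta> z w T ip_simps R'_mem
            resolvent_mem[OF A w] resolvent_mem[OF A z])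
      then have "cmod \<langle>(\<Theta> z - \<Theta> w - (z - w) *\<^sub>C T) *\<^sub>V b, c\<rangle> \<le> \<parallel>?r\<parallel> * \<parallel>C c\<parallel>"
        using cauchy_schwarz[OF r_mem C_mem[of c]] by simp
      also have "\<dots> \<le> ((cmod (z - w))\<^sup>2 * (M * norm b / \<delta> / \<delta> / \<delta>)) * (M * norm c)"
        using r_le M[of c] \<delta> \<open>0 \<le> M\<close> by (intro mult_mono) (auto simp: hnorm_nonneg)
      finally show "cmod \<langle>(\<Theta> z - \<Theta> w - (z - w) *\<^sub>C T) *\<^sub>V b, c\<rangle>
          \<le> M * M / \<delta> / \<delta> / \<delta> * (cmod (z - w))\<^sup>2 * norm b * norm c"
        by (simp add: mult_ac)
    qed (use \<delta> \<open>0 \<le> M\<close> in simp)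
    then show "\<exists>v K. \<exists>d>0. \<forall>z\<in>ball 0 1. cmod (z - w) < d \<longrightarrow>
        norm (\<Theta> z - \<Theta> w - (z - w) *\<^sub>C v) \<le> K * (cmod (z - w))\<^sup>2"
      using \<delta> by (intro exI[of _ T] exI[of _ "M * M / \<delta> / \<delta> / \<delta>"] exI[of _ \<delta>]) simp
  qed
  then show ?thesis using \<Theta> by (intro exI[of _ \<Theta>]) simp
qed

section \<open>From a representation to positivity and analyticity\<close>

text \<open>Polarization: \<open>V\<close> preserves the norms of \<open>x + c y\<close> for \<open>c = 1\<close> and \<open>c = \<i>\<close>.\<close>

lemma isometry_preserves_ip:
  assumes V: "isometry_in H ip V" and x: "x \<in> H" and y: "y \<in> H"
  shows "ip (V x) (V y) = ip x y"
proof -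
  have V_mem: "V u \<in> H" if "u \<in> H" for u using V that by (simp add: isometry_in_def)
  have "Re (cnj c * ip (V x) (V y)) = Re (cnj c * ip x y)" for c
  proof -
    have "V (x + c *\<^sub>C y) = V x + c *\<^sub>C V y"
      using V x y by (simp add: isometry_in_def scaleC_mem)
    moreover have "\<parallel>V u\<parallel> = \<parallel>u\<parallel>" if "u \<in> H" for u
      using V that by (simp add: isometry_in_def)
    ultimately have "\<parallel>V x + c *\<^sub>C V y\<parallel> = \<parallel>x + c *\<^sub>C y\<parallel>" "\<parallel>V x\<parallel> = \<parallel>x\<parallel>" "\<parallel>V y\<parallel> = \<parallel>y\<parallel>"
      using x y by (metis add_mem scaleC_mem)+
    then show ?thesis
      using hnorm_add_sq[of "V x" "c *\<^sub>C V y"] hnorm_add_sq[of x "c *\<^sub>C y"] x y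
      by (simp add: V_mem scaleC_mem hnorm_scaleC ip_scaleC_right)
  qed
  from this[of 1] this[of \<i>] show ?thesis by (simp add: complex_eq_iff)
qed

text \<open>With \<open>g = (I - z A\<^sup>*)\<^sup>-\<^sup>1 y\<close> and \<open>h = (I - z\<^sup>* A)\<^sup>-\<^sup>1 x\<close>, both sides equal
  \<open>\<langle>g, (I - z\<^sup>* A) h\<rangle> = \<langle>(I - z A\<^sup>*) g, h\<rangle>\<close>.\<close>

lemma ip_resolvent_adjoint:
  assumes A: "contraction_in H ip A" and z: "cmod z < 1" and x: "x \<in> H" and y: "y \<in> H"
  shows "ip (resolvent (hilbert_adjoint H ip A) z y) x = ip y (resolvent A (cnj z) x)"
proof -
  let ?B = "hilbert_adjoint H ip A"
  let ?g = "resolvent ?B z y" and ?h = "resolvent A (cnj z) x"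
  note B = contraction_hilbert_adjoint[OF A]
  have z': "cmod (cnj z) < 1" using z by simp
  have mem: "?g \<in> H" "?h \<in> H" "A ?h \<in> H" "?B ?g \<in> H"
    using resolvent_mem[OF B z y] resolvent_mem[OF A z' x] contraction_mem[OF A]
      contraction_mem[OF B] by auto
  have "ip ?g x = ip ?g (?h - cnj z *\<^sub>C A ?h)"
    using resolvent_solves[OF A z' x] by simp
  also have "\<dots> = ip (?g - z *\<^sub>C ?B ?g) ?h"
    using mem by (simp add: ip_simps ip_hilbert_adjoint[OF A])
  also have "\<dots> = ip y ?h" using resolvent_solves[OF B z y] by simp
  finally show ?thesis .
qed

context
  fixes V :: "'h \<Rightarrow> 'h" and C :: "'b::complex_banach \<Rightarrow> 'h" and D :: "('b, 'b cdual) cblinfun"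
    and \<Omega> :: "complex set"
  assumes V: "isometry_in H ip V" and C: "bounded_op_into H ip C" and \<Omega>: "\<Omega> \<subseteq> ball 0 1"
begin

private lemma A: "contraction_in H ip V"
  using V by (rule isometry_imp_contraction)

private lemma C_mem: "C b \<in> H"
  using C by (rule bounded_op_mem)

text \<open>Both operator identities are stated below as identities of sesquilinear forms, after
  \<open>resolvent_cayley\<close> has brought the Cayley transforms to the form \<open>2 (I - c A)\<^sup>-\<^sup>1 - I\<close>.\<close>

lemma represents_adjoint_iff:
  "represents_adjoint \<Omega> \<phi> H ip V C D \<longleftrightarrow>
    (\<forall>z\<in>\<Omega>. \<forall>b c. \<langle>\<phi> z *\<^sub>V c, b\<rangle> =
      cnj (\<langle>D *\<^sub>V b, c\<rangle> + ip (2 *\<^sub>C resolvent V (cnj z) (C b) - C b) (C c)))"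
proof -
  have "adjoint_restrict (\<phi> z) *\<^sub>V b =
      D *\<^sub>V b + adjoint_to_cdual ip C
        (inv_into H (\<lambda>h. h - cnj z *\<^sub>C V h) (C b + cnj z *\<^sub>C V (C b))) \<longleftrightarrow>
    (\<forall>c. \<langle>\<phi> z *\<^sub>V c, b\<rangle> =
      cnj (\<langle>D *\<^sub>V b, c\<rangle> + ip (2 *\<^sub>C resolvent V (cnj z) (C b) - C b) (C c)))"
    (is "?L = ?R \<longleftrightarrow> _") if "z \<in> \<Omega>" for z b
  proof -
    have z: "cmod (cnj z) < 1" using \<Omega> that by auto
    have R: "\<langle>?R, c\<rangle> = \<langle>D *\<^sub>V b, c\<rangle> + ip (2 *\<^sub>C resolvent V (cnj z) (C b) - C b) (C c)" for c
      using resolvent_cayley[OF A z C_mem]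
      by (simp add: cdual_rep_eq adjoint_to_cdual_apply[OF C] C_mem resolvent_mem[OF A z]
          mem_intros flip: resolvent_def)
    have ext: "?L = ?R \<longleftrightarrow> (\<forall>c. \<langle>?L, c\<rangle> = \<langle>?R, c\<rangle>)" by (auto intro: cdual_eqI)
    have flip: "cnj a = x \<longleftrightarrow> a = cnj x" for a x by auto
    show ?thesis
      unfolding ext R unfolding adjoint_restrict_apply flip ..
  qed
  then show ?thesis unfolding represents_adjoint_def by blast
qed

lemma represents_iff:
  "represents \<Omega> \<phi> H ip V C D \<longleftrightarrow>
    (\<forall>z\<in>\<Omega>. \<forall>b c. \<langle>\<phi> z *\<^sub>V b, c\<rangle> = cnj \<langle>D *\<^sub>V c, b\<rangle> +
      ip (2 *\<^sub>C resolvent (hilbert_adjoint H ip V) z (C b) - C b) (C c))"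
proof -
  note B = contraction_hilbert_adjoint[OF A]
  let ?B = "hilbert_adjoint H ip V"
  have "\<phi> z *\<^sub>V b = adjoint_restrict D *\<^sub>V b +
      (let V' = ?B; g = inv_into H (\<lambda>h. h - z *\<^sub>C V' h) (C b)
       in adjoint_to_cdual ip C (g + z *\<^sub>C V' g)) \<longleftrightarrow>
    (\<forall>c. \<langle>\<phi> z *\<^sub>V b, c\<rangle> = cnj \<langle>D *\<^sub>V c, b\<rangle> + ip (2 *\<^sub>C resolvent ?B z (C b) - C b) (C c))"
    (is "?L = ?R \<longleftrightarrow> _") if "z \<in> \<Omega>" for z b
  proof -
    have z: "cmod z < 1" using \<Omega> that by auto
    have R: "\<langle>?R, c\<rangle> = cnj \<langle>D *\<^sub>V c, b\<rangle> + ip (2 *\<^sub>C resolvent ?B z (C b) - C b) (C c)" for c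
      using resolvent_cayley(2)[OF B z C_mem[of b]]
      by (simp add: Let_def cdual_rep_eq adjoint_to_cdual_apply[OF C] C_mem resolvent_mem[OF B z]
          mem_intros adjoint_restrict_apply flip: resolvent_def)
    have ext: "?L = ?R \<longleftrightarrow> (\<forall>c. \<langle>?L, c\<rangle> = \<langle>?R, c\<rangle>)" by (auto intro: cdual_eqI)
    show ?thesis unfolding ext R ..
  qed
  then show ?thesis unfolding represents_def by blast
qed

lemma represents_adjoint_iff_represents:
  "represents_adjoint \<Omega> \<phi> H ip V C D \<longleftrightarrow> represents \<Omega> \<phi> H ip V C D"
proof -
  have "cnj (\<langle>D *\<^sub>V c, b\<rangle> + ip (2 *\<^sub>C resolvent V (cnj z) (C c) - C c) (C b)) =
      cnj \<langle>D *\<^sub>V c, b\<rangle> + ip (2 *\<^sub>C resolvent (hilbert_adjoint H ip V) z (C b) - C b) (C c)"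
    if "z \<in> \<Omega>" for z b c
  proof -
    have z: "cmod z < 1" "cmod (cnj z) < 1" using \<Omega> that by auto
    let ?g = "resolvent (hilbert_adjoint H ip V) z (C b)" and ?h = "resolvent V (cnj z) (C c)"
    have mem: "?g \<in> H" "?h \<in> H"
      by (rule resolvent_mem[OF contraction_hilbert_adjoint[OF A] z(1) C_mem])
        (rule resolvent_mem[OF A z(2) C_mem])
    have "cnj (ip (2 *\<^sub>C ?h - C c) (C b)) = ip (C b) (2 *\<^sub>C ?h - C c)"
      using mem by (intro ip_commute[symmetric] mem_intros C_mem)
    then show ?thesis
      using mem ip_resolvent_adjoint[OF A z(1) C_mem[of c] C_mem[of b]]
      by (simp add: C_mem ip_simps)
  qed
  then show ?thesis unfolding represents_adjoint_iff represents_iff by auto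
qed

text \<open>With \<open>p = (I - w\<^sup>* V)\<^sup>-\<^sup>1 C b\<close> and \<open>q = (I - z\<^sup>* V)\<^sup>-\<^sup>1 C c\<close>, the imaginary parts \<open>D\<close> cancel in
  \<open>\<phi>(z) + \<phi>(w)\<^sup>*\<close> and what remains is \<open>2 (\<langle>p, q\<rangle> - \<langle>w\<^sup>* V p, z\<^sup>* V q\<rangle>)\<close>, that is
  \<open>2 (1 - z w\<^sup>*) \<langle>p, q\<rangle>\<close> as \<open>V\<close> is isometric.\<close>

lemma kernel_eq_ip_resolvents:
  assumes D: "D + adjoint_restrict D = 0" and rep: "represents_adjoint \<Omega> \<phi> H ip V C D"
    and "z \<in> \<Omega>" "w \<in> \<Omega>"
  shows "\<langle>caratheodory_kernel \<phi> z w *\<^sub>V b, c\<rangle>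
    = ip (resolvent V (cnj w) (C b)) (resolvent V (cnj z) (C c))"
proof -
  have z: "cmod z < 1" and w: "cmod w < 1" and z': "cmod (cnj z) < 1" and w': "cmod (cnj w) < 1"
    using \<Omega> assms(3,4) by auto
  define p where "p = resolvent V (cnj w) (C b)"
  define q where "q = resolvent V (cnj z) (C c)"
  have p: "p \<in> H" and q: "q \<in> H"
    unfolding p_def q_def by (rule resolvent_mem[OF A w' C_mem] resolvent_mem[OF A z' C_mem])+
  have Vp: "V p \<in> H" and Vq: "V q \<in> H" using contraction_mem[OF A] p q by auto
  have Cb: "C b = p - cnj w *\<^sub>C V p" and Cc: "C c = q - cnj z *\<^sub>C V q"
    using resolvent_solves[OF A w' C_mem] resolvent_solves[OF A z' C_mem]
    by (simp_all add: p_def q_def)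
  have "\<langle>(D + adjoint_restrict D) *\<^sub>V b, c\<rangle> = 0" by (simp add: D cblinfun_rep_eq cdual_rep_eq)
  then have D': "cnj \<langle>D *\<^sub>V c, b\<rangle> = - \<langle>D *\<^sub>V b, c\<rangle>"
    by (simp add: cblinfun_rep_eq cdual_rep_eq adjoint_restrict_apply add_eq_0_iff)
  have "\<langle>\<phi> z *\<^sub>V b, c\<rangle> = cnj (\<langle>D *\<^sub>V c, b\<rangle> + ip (2 *\<^sub>C q - C c) (C b))"
    using rep[unfolded represents_adjoint_iff] assms(3) by (simp add: q_def)
  also have "\<dots> = - \<langle>D *\<^sub>V b, c\<rangle> + ip (C b) (2 *\<^sub>C q - C c)"
    using q ip_commute[of "2 *\<^sub>C q - C c" "C b"] by (simp add: D' mem_intros C_mem)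
  finally have \<phi>z: "\<langle>\<phi> z *\<^sub>V b, c\<rangle> = - \<langle>D *\<^sub>V b, c\<rangle> + ip (C b) (2 *\<^sub>C q - C c)" .
  have \<phi>w: "cnj \<langle>\<phi> w *\<^sub>V c, b\<rangle> = \<langle>D *\<^sub>V b, c\<rangle> + ip (2 *\<^sub>C p - C b) (C c)"
    using rep[unfolded represents_adjoint_iff] assms(4) by (simp add: p_def)
  have "ip (C b) (2 *\<^sub>C q - C c) + ip (2 *\<^sub>C p - C b) (C c)
      = 2 * (ip p q - z * cnj w * ip (V p) (V q))"
    unfolding Cb Cc using p q Vp Vq by (simp add: ip_simps) (simp add: algebra_simps)
  also have "\<dots> = 2 * (1 - z * cnj w) * ip p q"
    using isometry_preserves_ip[OF V p q] by (simp add: algebra_simps)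
  finally have sum: "\<langle>\<phi> z *\<^sub>V b, c\<rangle> + cnj \<langle>\<phi> w *\<^sub>V c, b\<rangle> = 2 * (1 - z * cnj w) * ip p q"
    by (simp add: \<phi>z \<phi>w)
  have "cmod (z * cnj w) < 1"
    using mult_strict_mono'[OF z w] by (simp add: norm_mult)
  then have "1 - z * cnj w \<noteq> 0" by auto
  then show ?thesis
    using sum by (simp add: caratheodory_kernel_def cblinfun_rep_eq cdual_rep_eq
        adjoint_restrict_apply p_def[symmetric] q_def[symmetric])
qed

lemma positive_kernel_if_represents_adjoint:
  assumes "D + adjoint_restrict D = 0" "represents_adjoint \<Omega> \<phi> H ip V C D"
  shows "positive_kernel \<Omega> (caratheodory_kernel \<phi>)"
  unfolding positive_kernel_def
proof (intro allI impI)
  fix n and z :: "nat \<Rightarrow> complex" and b :: "nat \<Rightarrow> 'b"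
  assume z: "\<forall>i<n. z i \<in> \<Omega>"
  define u where "u i = resolvent V (cnj (z i)) (C (b i))" for i
  have u: "u i \<in> H" if "i < n" for i
    unfolding u_def using \<Omega> z that by (intro resolvent_mem[OF A _ C_mem]) auto
  then have S: "sum u {..<n} \<in> H" by (intro sum_mem) simp
  have "(\<Sum>i<n. \<Sum>j<n. \<langle>caratheodory_kernel \<phi> (z i) (z j) *\<^sub>V b j, b i\<rangle>)
      = (\<Sum>i<n. \<Sum>j<n. ip (u j) (u i))"
    using z by (simp add: u_def kernel_eq_ip_resolvents[OF assms])
  also have "\<dots> = (\<Sum>i<n. ip (sum u {..<n}) (u i))"
    using u by (intro sum.cong refl ip_sum_left[symmetric]) simp_all
  also have "\<dots> = ip (sum u {..<n}) (sum u {..<n})"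
    using u S by (intro ip_sum_right[symmetric]) simp_all
  finally show "(\<Sum>i<n. \<Sum>j<n. \<langle>caratheodory_kernel \<phi> (z i) (z j) *\<^sub>V b j, b i\<rangle>) \<in> \<real>\<^sub>\<ge>\<^sub>0"
    using S by (simp add: ip_self nonneg_Reals_of_real_iff del: of_real_power)
qed

text \<open>The second form of the representation is \<open>D\<^sup>* - C\<^sup>* C + 2 C\<^sup>* (I - z V\<^sup>*)\<^sup>-\<^sup>1 C\<close>, which is
  defined on the whole disk.\<close>

lemma holomorphic_extension_if_represents:
  assumes "represents \<Omega> \<phi> H ip V C D"
  shows "\<exists>\<psi>. (\<forall>z\<in>\<Omega>. \<psi> z = \<phi> z) \<and> vector_holomorphic_on \<psi> (ball 0 1)"
proof -
  note B = contraction_hilbert_adjoint[OF A]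
  let ?B = "hilbert_adjoint H ip V"
  obtain \<Theta> :: "complex \<Rightarrow> ('b, 'b cdual) cblinfun"
    where "\<forall>z\<in>ball 0 1. \<forall>b c. \<langle>\<Theta> z *\<^sub>V b, c\<rangle> = ip (resolvent ?B z (C b)) (C c)"
      and hol: "vector_holomorphic_on \<Theta> (ball 0 1)"
    using holomorphic_compressed_resolvent[OF B C] by blast
  then have \<Theta>: "\<langle>\<Theta> z *\<^sub>V b, c\<rangle> = ip (resolvent ?B z (C b)) (C c)" if "cmod z < 1" for z b c
    using that by simp
  \<comment> \<open>\<open>\<Theta> 0 = C\<^sup>* C\<close>, as the resolvent at \<open>0\<close> is the identity.\<close>
  have \<Theta>_0: "\<langle>\<Theta> 0 *\<^sub>V b, c\<rangle> = ip (C b) (C c)" for b c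
    using \<Theta>[of 0] resolvent_eqI[OF B _ C_mem, of 0 b "C b"] by simp
  let ?\<psi> = "\<lambda>z. (adjoint_restrict D - \<Theta> 0) + 2 *\<^sub>C \<Theta> z"
  have "?\<psi> z = \<phi> z" if "z \<in> \<Omega>" for z
  proof (intro cblinfun_eqI cdual_eqI)
    fix b c
    have z: "cmod z < 1" using \<Omega> that by auto
    show "\<langle>?\<psi> z *\<^sub>V b, c\<rangle> = \<langle>\<phi> z *\<^sub>V b, c\<rangle>"
      using assms[unfolded represents_iff] that
      by (simp add: cblinfun_rep_eq cdual_rep_eq adjoint_restrict_apply \<Theta>_0 \<Theta> z ip_simps C_mem
          resolvent_mem[OF B z])
  qed
  then show ?thesis
    using vector_holomorphic_on_affine[OF hol, of "adjoint_restrict D - \<Theta> 0" 2]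
    by (intro exI[of _ ?\<psi>]) simp
qed

end

end

section \<open>The reproducing kernel Hilbert space of a positive kernel\<close>

text \<open>
  The space consists of the functions \<open>f\<close> that are bounded as antilinear functionals on the finite
  combinations of kernel functions; it is complete for the dual norm. Two points need work, the
  inner product and the density of the finite combinations. Both follow from writing the
  squared dual norm as the supremum of a concave quadratic expression (\<open>energy\<close>): by completing the
  square, combinations that nearly attain the supremum approximate \<open>f\<close>, and \<open>\<langle>f, g\<rangle>\<close> is the limit
  of the values of \<open>f\<close> at combinations approximating \<open>g\<close>.
\<close>

text \<open>A list of pairs \<open>(z, b)\<close> stands for the finite combination of kernel functions
  \<open>\<Sum> K(\<cdot>, z) b\<close>; \<open>pairing f v\<close> is the value that \<open>\<langle>f, \<Sum> K(\<cdot>, z) b\<rangle>\<close> must have in a space in which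
  evaluation is reproduced by the kernel.\<close>

definition pairing :: "('a \<Rightarrow> 'b::complex_normed_vector cdual) \<Rightarrow> ('a \<times> 'b) list \<Rightarrow> complex"
  where "pairing f v = (\<Sum>(z, b)\<leftarrow>v. \<langle>f z, b\<rangle>)"

definition scale_comb :: "complex \<Rightarrow> ('a \<times> 'b::complex_vector) list \<Rightarrow> ('a \<times> 'b) list"
  where "scale_comb c v = map (\<lambda>(z, b). (z, c *\<^sub>C b)) v"

lemma pairing_Nil [simp]: "pairing f [] = 0"
  and pairing_Cons [simp]: "pairing f ((z, b) # v) = \<langle>f z, b\<rangle> + pairing f v"
  and pairing_append: "pairing f (u @ v) = pairing f u + pairing f v"
  by (simp_all add: pairing_def)

lemma scale_comb_Nil [simp]: "scale_comb c [] = []"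
  and scale_comb_Cons [simp]: "scale_comb c ((z, b) # v) = (z, c *\<^sub>C b) # scale_comb c v"
  by (simp_all add: scale_comb_def)

lemma pairing_scale_comb: "pairing f (scale_comb c v) = cnj c * pairing f v"
  by (induction v) (auto simp: cdual_scaleC_right algebra_simps)

lemma pairing_add: "pairing (f + g) v = pairing f v + pairing g v"
  by (induction v) (auto simp: cdual_rep_eq)

lemma pairing_diff: "pairing (f - g) v = pairing f v - pairing g v"
  by (induction v) (auto simp: cdual_rep_eq)

lemma pairing_scaleC: "pairing (c *\<^sub>C f) v = c * pairing f v"
  by (induction v) (auto simp: cdual_rep_eq scaleC_fun_def algebra_simps)

lemma pairing_zero [simp]: "pairing 0 v = 0"
  by (induction v) (auto simp: cdual_rep_eq)

locale positive_definite_kernel =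
  fixes K :: "complex \<Rightarrow> complex \<Rightarrow> ('b::complex_normed_vector, 'b cdual) cblinfun"
  assumes positive: "positive_kernel UNIV K"
begin

definition comb :: "(complex \<times> 'b) list \<Rightarrow> complex \<Rightarrow> 'b cdual"
  where "comb u z = (\<Sum>(w, b)\<leftarrow>u. K z w *\<^sub>V b)"

definition gram :: "(complex \<times> 'b) list \<Rightarrow> (complex \<times> 'b) list \<Rightarrow> complex"
  where "gram u v = pairing (comb u) v"

lemma comb_Nil [simp]: "comb [] = 0"
  and comb_Cons: "comb ((w, b) # u) = (\<lambda>z. K z w *\<^sub>V b) + comb u"
  by (simp_all add: comb_def fun_eq_iff)

lemma comb_append: "comb (u @ v) = comb u + comb v"
  by (simp add: comb_def fun_eq_iff)

lemma comb_scale_comb: "comb (scale_comb c u) = c *\<^sub>C comb u"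
  by (induction u)
    (auto simp: comb_Cons fun_eq_iff scaleC_fun_def cblinfun_scaleC_right scaleC_add_right)

lemma gram_append_left: "gram (u @ u') v = gram u v + gram u' v"
  and gram_append_right: "gram u (v @ v') = gram u v + gram u v'"
  and gram_scale_left: "gram (scale_comb c u) v = c * gram u v"
  and gram_scale_right: "gram u (scale_comb c v) = cnj c * gram u v"
  by (simp_all add: gram_def comb_append comb_scale_comb pairing_append pairing_add
      pairing_scale_comb pairing_scaleC)

lemmas gram_simps = gram_append_left gram_append_right gram_scale_left gram_scale_right

lemma gram_self_nonneg: "gram u u \<in> \<real>\<^sub>\<ge>\<^sub>0"
proof -
  have apply_sum: "\<langle>\<Sum>i\<in>I. g i, b\<rangle> = (\<Sum>i\<in>I. \<langle>g i, b\<rangle>)" for I :: "nat set" and g and b :: 'b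
    by (induction I rule: infinite_finite_induct) (simp_all add: cdual_rep_eq)
  have "gram u u = (\<Sum>i<length u. \<Sum>j<length u.
      \<langle>K (fst (u ! i)) (fst (u ! j)) *\<^sub>V snd (u ! j), snd (u ! i)\<rangle>)"
    by (simp add: gram_def pairing_def comb_def apply_sum sum_list_sum_nth case_prod_beta
        comp_def atLeast0LessThan)
  then show ?thesis using positive by (simp add: positive_kernel_def)
qed

abbreviation sq :: "(complex \<times> 'b) list \<Rightarrow> real"
  where "sq v \<equiv> Re (gram v v)"

lemma sq_nonneg: "0 \<le> sq v"
  using gram_self_nonneg[of v] by (auto simp: complex_nonneg_Reals_iff)

text \<open>The Gram form of \<open>u + c v\<close> with itself is real for \<open>c = 1\<close> and \<open>c = \<i>\<close>.\<close>

lemma gram_commute: "gram v u = cnj (gram u v)"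
proof -
  have real: "Im (gram w w) = 0" for w
    using gram_self_nonneg[of w] by (auto simp: complex_nonneg_Reals_iff)
  show ?thesis
    using real[of "u @ v"] real[of "u @ scale_comb \<i> v"] real[of u] real[of v]
    by (simp add: gram_simps complex_eq_iff)
qed

definition energy :: "(complex \<Rightarrow> 'b cdual) \<Rightarrow> (complex \<times> 'b) list \<Rightarrow> real"
  where "energy f v = 2 * Re (pairing f v) - sq v"

definition kspace :: "(complex \<Rightarrow> 'b cdual) set"
  where "kspace = {f. \<exists>M\<ge>0. \<forall>v. cmod (pairing f v) \<le> M * sqrt (sq v)}"

text \<open>The squared dual norm. Written as a supremum of \<open>energy\<close>, which is concave in \<open>v\<close>, it
  comes with maximising sequences, and these approximate \<open>f\<close>.\<close>

definition Q :: "(complex \<Rightarrow> 'b cdual) \<Rightarrow> real"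
  where "Q f = (SUP v. energy f v)"

lemma energy_le_if_pairing_le:
  assumes "\<And>v. cmod (pairing f v) \<le> M * sqrt (sq v)"
  shows "energy f v \<le> M\<^sup>2"
proof -
  have "energy f v \<le> 2 * (M * sqrt (sq v)) - (sqrt (sq v))\<^sup>2"
    using assms[of v] complex_Re_le_cmod[of "pairing f v"] by (simp add: energy_def sq_nonneg)
  also have "\<dots> = M\<^sup>2 - (M - sqrt (sq v))\<^sup>2" by (simp add: power2_diff)
  finally show ?thesis using zero_le_power2[of "M - sqrt (sq v)"] by linarith
qed

lemma energy_le_Q:
  assumes "f \<in> kspace"
  shows "energy f v \<le> Q f"
proof -
  obtain M where "\<And>v. cmod (pairing f v) \<le> M * sqrt (sq v)"
    using assms by (auto simp: kspace_def)
  then have "\<And>v. energy f v \<le> M\<^sup>2" by (rule energy_le_if_pairing_le)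
  then have "bdd_above (range (energy f))" by (rule bdd_aboveI2)
  then show ?thesis unfolding Q_def by (intro cSUP_upper UNIV_I)
qed

lemma Q_le_if_pairing_le:
  assumes "\<And>v. cmod (pairing f v) \<le> M * sqrt (sq v)"
  shows "Q f \<le> M\<^sup>2"
  unfolding Q_def by (rule cSUP_least) (use energy_le_if_pairing_le[OF assms] in auto)

lemma pairing_sq_le_if_energy_le:
  assumes "\<And>v. energy f v \<le> M"
  shows "(cmod (pairing f v))\<^sup>2 \<le> M * sq v"
proof (rule complex_quadratic_bound)
  fix c
  have "gram (scale_comb c v) (scale_comb c v) = of_real ((cmod c)\<^sup>2) * gram v v"
    by (simp only: complex_norm_square) (simp add: gram_simps)
  then have "sq (scale_comb c v) = (cmod c)\<^sup>2 * sq v" by simp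
  then show "2 * Re (cnj c * pairing f v) - (cmod c)\<^sup>2 * sq v \<le> M"
    using assms[of "scale_comb c v"] by (simp add: energy_def pairing_scale_comb)
qed (rule sq_nonneg)

lemma pairing_sq_le: "f \<in> kspace \<Longrightarrow> (cmod (pairing f v))\<^sup>2 \<le> Q f * sq v"
  by (intro pairing_sq_le_if_energy_le energy_le_Q)

lemma Q_nonneg: "f \<in> kspace \<Longrightarrow> 0 \<le> Q f"
  using energy_le_Q[of f "[]"] by (simp add: energy_def gram_def)

lemma pairing_le: "f \<in> kspace \<Longrightarrow> cmod (pairing f v) \<le> sqrt (Q f) * sqrt (sq v)"
  using pairing_sq_le[of f v] by (simp add: real_le_rsqrt flip: real_sqrt_mult)

lemma sq_diff: "sq (u @ scale_comb (-1) v) = sq u - 2 * Re (gram u v) + sq v"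
  using gram_commute[of u v] by (simp add: gram_simps)

lemma energy_comb_le: "energy (comb u) v \<le> sq u"
  using sq_nonneg[of "u @ scale_comb (-1) v"] unfolding sq_diff
  by (simp add: energy_def gram_def)

lemma comb_mem: "comb u \<in> kspace"
proof -
  have "cmod (pairing (comb u) v) \<le> sqrt (sq u) * sqrt (sq v)" for v
    using pairing_sq_le_if_energy_le[OF energy_comb_le, of u v]
    by (simp add: real_le_rsqrt flip: real_sqrt_mult)
  then show ?thesis using sq_nonneg[of u] by (auto simp: kspace_def intro!: exI[of _ "sqrt (sq u)"])
qed

lemma energy_comb_self: "energy (comb u) u = sq u"
  by (simp add: energy_def gram_def)

lemma Q_comb: "Q (comb u) = sq u"
proof (rule antisym)
  show "Q (comb u) \<le> sq u"
    unfolding Q_def by (rule cSUP_least) (simp_all add: energy_comb_le)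
  show "sq u \<le> Q (comb u)"
    using energy_le_Q[OF comb_mem, of u u] by (simp add: energy_comb_self)
qed

lemma kspace_add:
  assumes "f \<in> kspace" "g \<in> kspace"
  shows "f + g \<in> kspace"
proof -
  obtain M N where "0 \<le> M" "0 \<le> N"
    and "\<And>v. cmod (pairing f v) \<le> M * sqrt (sq v)" "\<And>v. cmod (pairing g v) \<le> N * sqrt (sq v)"
    using assms by (auto simp: kspace_def)
  moreover from this have "cmod (pairing (f + g) v) \<le> (M + N) * sqrt (sq v)" for v
    using norm_triangle_ineq[of "pairing f v" "pairing g v"]
    by (simp add: pairing_add distrib_right) (meson add_mono order_trans)
  ultimately show ?thesis by (auto simp: kspace_def intro!: exI[of _ "M + N"])
qed

lemma kspace_scaleC:
  assumes "f \<in> kspace"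
  shows "c *\<^sub>C f \<in> kspace"
proof -
  obtain M where "0 \<le> M" "\<And>v. cmod (pairing f v) \<le> M * sqrt (sq v)"
    using assms by (auto simp: kspace_def)
  then show ?thesis
    by (auto simp: kspace_def pairing_scaleC norm_mult mult.assoc
        intro!: exI[of _ "cmod c * M"] mult_left_mono)
qed

lemma kspace_diff: "f \<in> kspace \<Longrightarrow> g \<in> kspace \<Longrightarrow> f - g \<in> kspace"
  using kspace_add[OF _ kspace_scaleC[of g "-1"]] by (fastforce simp: scaleC_minus_one)

text \<open>Completing the square: passing from \<open>f\<close> to \<open>f - comb u\<close> translates the argument of
  \<open>energy\<close>. Hence a nearly maximising \<open>u\<close> gives a good approximation \<open>comb u\<close> of \<open>f\<close>.\<close>

lemma energy_diff_comb: "energy (f - comb u) v = energy f (v @ u) - energy f u"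
  using gram_commute[of u v]
  by (simp add: energy_def pairing_append pairing_diff gram_simps flip: gram_def)

lemma Q_diff_comb_le: "f \<in> kspace \<Longrightarrow> Q (f - comb u) \<le> Q f - energy f u"
  unfolding Q_def[of "f - comb u"]
  by (rule cSUP_least) (auto simp: energy_diff_comb energy_le_Q)

text \<open>Comparing the energy at the midpoint of \<open>u\<close> and \<open>v\<close> with the supremum, by the parallelogram law
  for \<open>gram\<close>: lists that nearly maximise the energy are close to each other.\<close>

lemma sq_diff_le_energy_gaps:
  assumes "f \<in> kspace"
  shows "sq (u @ scale_comb (-1) v) \<le> 2 * (Q f - energy f u) + 2 * (Q f - energy f v)"
proof -
  have "4 * energy f (scale_comb (1/2) (u @ v))
      = 2 * energy f u + 2 * energy f v + sq (u @ scale_comb (-1) v)"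
    using gram_commute[of u v]
    by (simp add: energy_def pairing_scale_comb pairing_append gram_simps algebra_simps)
  then show ?thesis using energy_le_Q[OF assms, of "scale_comb (1/2) (u @ v)"] by simp
qed

definition approx :: "(complex \<Rightarrow> 'b cdual) \<Rightarrow> nat \<Rightarrow> (complex \<times> 'b) list"
  where "approx f n = (SOME u. Q f - 1 / real (Suc n) < energy f u)"

lemma energy_approx: "Q f - 1 / real (Suc n) < energy f (approx f n)" if "f \<in> kspace"
  unfolding approx_def
proof (rule someI_ex)
  have "bdd_above (range (energy f))"
    using energy_le_Q[OF that] by (rule bdd_aboveI2)
  moreover have "Q f - 1 / real (Suc n) < (SUP u. energy f u)" by (simp add: Q_def)
  ultimately show "\<exists>u. Q f - 1 / real (Suc n) < energy f u"
    using less_cSUP_iff[of UNIV "energy f"] by blast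
qed

lemma energy_approx_tendsto:
  assumes "f \<in> kspace"
  shows "(\<lambda>n. Q f - energy f (approx f n)) \<longlonglongrightarrow> 0"
proof (rule tendsto_sandwich[where f = "\<lambda>_. 0" and h = "\<lambda>n. 1 / real (Suc n)"])
  show "(\<lambda>n. 1 / real (Suc n)) \<longlonglongrightarrow> 0"
    using LIMSEQ_inverse_real_of_nat by (simp add: inverse_eq_divide)
  show "\<forall>\<^sub>F n in sequentially. Q f - energy f (approx f n) \<le> 1 / real (Suc n)"
    using energy_approx[OF assms] by (auto simp: algebra_simps less_imp_le intro!: always_eventually)
  show "\<forall>\<^sub>F n in sequentially. 0 \<le> Q f - energy f (approx f n)"
    using energy_le_Q[OF assms] by simp
qed simp

lemma pairing_diff_le:
  assumes "f \<in> kspace" "g \<in> kspace"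
  shows "cmod (pairing f u - pairing f v)
    \<le> sqrt (Q f) * sqrt (2 * (Q g - energy g u) + 2 * (Q g - energy g v))"
proof -
  have "cmod (pairing f (u @ scale_comb (-1) v)) \<le> sqrt (Q f) * sqrt (sq (u @ scale_comb (-1) v))"
    by (rule pairing_le[OF assms(1)])
  also have "\<dots> \<le> sqrt (Q f) * sqrt (2 * (Q g - energy g u) + 2 * (Q g - energy g v))"
    by (intro mult_left_mono real_sqrt_le_mono sq_diff_le_energy_gaps assms real_sqrt_ge_zero Q_nonneg)
  finally show ?thesis by (simp add: pairing_append pairing_scale_comb)
qed

definition kip :: "(complex \<Rightarrow> 'b cdual) \<Rightarrow> (complex \<Rightarrow> 'b cdual) \<Rightarrow> complex"
  where "kip f g = lim (\<lambda>n. pairing f (approx g n))"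

lemma pairing_approx_tendsto:
  assumes f: "f \<in> kspace" and g: "g \<in> kspace"
  shows "(\<lambda>n. pairing f (approx g n)) \<longlonglongrightarrow> kip f g"
proof -
  let ?gap = "\<lambda>n. Q g - energy g (approx g n)"
  have "Cauchy (\<lambda>n. pairing f (approx g n))"
  proof (rule metric_CauchyI)
    fix e :: real assume "0 < e"
    have "(\<lambda>n. sqrt (Q f) * sqrt (4 * (1 / real (Suc n)))) \<longlonglongrightarrow> sqrt (Q f) * sqrt (4 * 0)"
      using LIMSEQ_inverse_real_of_nat by (intro tendsto_intros) (simp add: inverse_eq_divide)
    then have "\<forall>\<^sub>F n in sequentially. sqrt (Q f) * sqrt (4 * (1 / real (Suc n))) < e"
      by (rule order_tendstoD(2)) (simp add: \<open>0 < e\<close>)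
    then obtain N where "sqrt (Q f) * sqrt (4 * (1 / real (Suc N))) < e"
      unfolding eventually_sequentially by blast
    moreover define r where "r = 1 / real (Suc N)"
    ultimately have r: "sqrt (Q f) * sqrt (4 * r) < e" by simp
    have gap: "?gap n \<le> r" if "n \<ge> N" for n
    proof -
      have "1 / real (Suc n) \<le> r" unfolding r_def using that by (simp add: frac_le)
      then show ?thesis using energy_approx[OF g, of n] by linarith
    qed
    have "dist (pairing f (approx g m)) (pairing f (approx g n)) < e" if "m \<ge> N" "n \<ge> N" for m n
    proof -
      have "dist (pairing f (approx g m)) (pairing f (approx g n))
          \<le> sqrt (Q f) * sqrt (2 * ?gap m + 2 * ?gap n)"
        unfolding dist_norm by (rule pairing_diff_le[OF f g])
      also have "\<dots> \<le> sqrt (Q f) * sqrt (4 * r)"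
        using gap[OF that(1)] gap[OF that(2)] Q_nonneg[OF f] by (simp add: mult_left_mono)
      finally show ?thesis using r by linarith
    qed
    then show "\<exists>N. \<forall>m\<ge>N. \<forall>n\<ge>N. dist (pairing f (approx g m)) (pairing f (approx g n)) < e" by blast
  qed
  then have "convergent (\<lambda>n. pairing f (approx g n))"
    by (rule Cauchy_convergent)
  then show ?thesis unfolding kip_def by (simp add: convergent_LIMSEQ_iff)
qed

text \<open>The list \<open>u\<close> maximises the energy of \<open>comb u\<close>, so it may replace the chosen approximations of
  \<open>comb u\<close> in the definition of the inner product.\<close>

lemma kip_comb:
  assumes f: "f \<in> kspace"
  shows "kip f (comb u) = pairing f u"
proof -
  have "(\<lambda>n. pairing f (approx (comb u) n) - pairing f u) \<longlonglongrightarrow> 0"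
  proof (rule Lim_null_comparison)
    let ?e = "\<lambda>n. sqrt (Q f) * sqrt (2 * (Q (comb u) - energy (comb u) (approx (comb u) n)))"
    show "\<forall>\<^sub>F n in sequentially. norm (pairing f (approx (comb u) n) - pairing f u) \<le> ?e n"
      using pairing_diff_le[OF f comb_mem, of _ u u] by (simp add: Q_comb energy_comb_self)
    have "?e \<longlonglongrightarrow> sqrt (Q f) * sqrt (2 * 0)"
      by (intro tendsto_intros energy_approx_tendsto comb_mem)
    then show "?e \<longlonglongrightarrow> 0" by simp
  qed
  then have "(\<lambda>n. pairing f (approx (comb u) n)) \<longlonglongrightarrow> pairing f u" by (rule LIM_zero_cancel)
  then show ?thesis using pairing_approx_tendsto[OF f comb_mem] LIMSEQ_unique by blast
qed

text \<open>Near-maximising lists have bounded norm: Cauchy-Schwarz turns the energy gap into a bound of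
  \<open>(sqrt (sq v) - sqrt (Q f))\<^sup>2\<close>.\<close>

lemma sqrt_sq_le:
  assumes "f \<in> kspace"
  shows "sqrt (sq v) \<le> sqrt (Q f) + sqrt (Q f - energy f v)"
proof -
  have "Re (pairing f v) \<le> sqrt (Q f) * sqrt (sq v)"
    using pairing_le[OF assms, of v] complex_Re_le_cmod order_trans by blast
  then have "(sqrt (sq v) - sqrt (Q f))\<^sup>2 \<le> Q f - energy f v"
    using Q_nonneg[OF assms] by (simp add: energy_def power2_diff sq_nonneg algebra_simps)
  then have "\<bar>sqrt (sq v) - sqrt (Q f)\<bar> \<le> sqrt (Q f - energy f v)"
    by (metis real_sqrt_abs real_sqrt_le_iff)
  then show ?thesis by linarith
qed

text \<open>The inner product is also the limit of the Gram form of approximations of both arguments. This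
  form is Hermitian, and the energies of the approximations tend to \<open>Q f\<close>, which gives
  \<open>kip_commute\<close> and \<open>Q_eq_kip\<close>.\<close>

lemma gram_approx_tendsto:
  assumes f: "f \<in> kspace" and g: "g \<in> kspace"
  shows "(\<lambda>n. gram (approx f n) (approx g n)) \<longlonglongrightarrow> kip f g"
proof -
  let ?gap = "\<lambda>f n. Q f - energy f (approx f n)"
  have "(\<lambda>n. pairing f (approx g n) - gram (approx f n) (approx g n)) \<longlonglongrightarrow> 0"
  proof (rule Lim_null_comparison)
    let ?e = "\<lambda>n. sqrt (?gap f n) * (sqrt (Q g) + sqrt (?gap g n))"
    have "cmod (pairing f (approx g n) - gram (approx f n) (approx g n)) \<le> ?e n" for n
    proof -
      have "cmod (pairing (f - comb (approx f n)) (approx g n))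
          \<le> sqrt (Q (f - comb (approx f n))) * sqrt (sq (approx g n))"
        by (intro pairing_le kspace_diff f comb_mem)
      also have "\<dots> \<le> ?e n"
        by (intro mult_mono real_sqrt_le_mono Q_diff_comb_le sqrt_sq_le f g real_sqrt_ge_zero
            sq_nonneg) (simp add: energy_le_Q f)
      finally show ?thesis by (simp add: pairing_diff gram_def)
    qed
    then show "\<forall>\<^sub>F n in sequentially.
        norm (pairing f (approx g n) - gram (approx f n) (approx g n)) \<le> ?e n" by simp
    have "?e \<longlonglongrightarrow> sqrt 0 * (sqrt (Q g) + sqrt 0)"
      by (intro tendsto_intros energy_approx_tendsto f g)
    then show "?e \<longlonglongrightarrow> 0" by simp
  qed
  from tendsto_diff[OF pairing_approx_tendsto[OF f g] this] show ?thesis by simp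
qed

lemma kip_commute:
  assumes "f \<in> kspace" "g \<in> kspace"
  shows "kip g f = cnj (kip f g)"
proof -
  have "(\<lambda>n. gram (approx g n) (approx f n)) \<longlonglongrightarrow> cnj (kip f g)"
    using tendsto_cnj[OF gram_approx_tendsto[OF assms]] by (simp flip: gram_commute)
  then show ?thesis using gram_approx_tendsto[OF assms(2,1)] LIMSEQ_unique by blast
qed

lemma Q_eq_kip:
  assumes "f \<in> kspace"
  shows "Q f = Re (kip f f)"
proof -
  have "(\<lambda>n. energy f (approx f n)) \<longlonglongrightarrow> 2 * Re (kip f f) - Re (kip f f)"
    unfolding energy_def
    by (intro tendsto_intros pairing_approx_tendsto gram_approx_tendsto assms)
  from tendsto_add[OF energy_approx_tendsto[OF assms] this]
  have "(\<lambda>n::nat. Q f) \<longlonglongrightarrow> Re (kip f f)" by simp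
  then show ?thesis by (simp add: tendsto_const_iff)
qed

lemma ip_norm_kip: "f \<in> kspace \<Longrightarrow> ip_norm kip f = sqrt (Q f)"
  by (simp add: ip_norm_def Q_eq_kip)

lemma pairing_le_ip_norm: "f \<in> kspace \<Longrightarrow> cmod (pairing f v) \<le> ip_norm kip f * sqrt (sq v)"
  by (simp add: ip_norm_kip pairing_le)

text \<open>A Cauchy sequence converges pointwise, and the estimate \<open>pairing_le_ip_norm\<close> passes to the
  limit, so that the pointwise limit is a limit in norm.\<close>

lemma kspace_complete:
  assumes X: "\<And>n. X n \<in> kspace"
    and Cauchy: "\<And>e. e > 0 \<Longrightarrow> \<exists>N. \<forall>m\<ge>N. \<forall>n\<ge>N. ip_norm kip (X m - X n) < e"
  shows "\<exists>L\<in>kspace. (\<lambda>n. ip_norm kip (X n - L)) \<longlonglongrightarrow> 0"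
proof -
  have diff: "cmod (pairing (X m) v - pairing (X n) v) \<le> ip_norm kip (X m - X n) * sqrt (sq v)"
    for m n v
    using pairing_le_ip_norm[OF kspace_diff[OF X X]] by (simp add: pairing_diff)
  have "convergent (\<lambda>n. pairing (X n) v)" for v
  proof (rule Cauchy_convergent, rule metric_CauchyI)
    fix e :: real assume "0 < e"
    define s where "s = sqrt (sq v)"
    have "0 \<le> s" by (simp add: s_def sq_nonneg)
    obtain N where N: "\<And>m n. m \<ge> N \<Longrightarrow> n \<ge> N \<Longrightarrow> ip_norm kip (X m - X n) < e / (s + 1)"
      using Cauchy[of "e / (s + 1)"] \<open>0 < e\<close> \<open>0 \<le> s\<close> by auto
    have "dist (pairing (X m) v) (pairing (X n) v) < e" if "m \<ge> N" "n \<ge> N" for m n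
    proof -
      have "dist (pairing (X m) v) (pairing (X n) v) \<le> e / (s + 1) * s"
        using diff[of m v n] mult_right_mono[OF less_imp_le[OF N[OF that]] \<open>0 \<le> s\<close>]
        by (simp add: dist_norm s_def)
      also have "\<dots> < e" using \<open>0 < e\<close> \<open>0 \<le> s\<close> by (simp add: divide_less_eq)
      finally show ?thesis .
    qed
    then show "\<exists>N. \<forall>m\<ge>N. \<forall>n\<ge>N. dist (pairing (X m) v) (pairing (X n) v) < e" by blast
  qed
  then have "\<exists>l. (\<lambda>n. pairing (X n) v) \<longlonglongrightarrow> l" for v by (simp add: convergent_def)
  then obtain l where l: "\<And>v. (\<lambda>n. pairing (X n) v) \<longlonglongrightarrow> l v" by metis
  obtain N1 where N1: "\<And>n. n \<ge> N1 \<Longrightarrow> ip_norm kip (X n - X N1) < 1"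
    using Cauchy[of 1] by auto
  define B where "B = ip_norm kip (X N1) + 1"
  have "0 \<le> B" using Q_nonneg[OF X] by (simp add: B_def ip_norm_kip X)
  have l_le: "cmod (l v) \<le> B * sqrt (sq v)" for v
  proof (rule LIMSEQ_le_const2[OF tendsto_norm[OF l]], intro exI allI impI)
    fix n assume "N1 \<le> n"
    have "cmod (pairing (X n) v) \<le> cmod (pairing (X N1) v) + cmod (pairing (X n) v - pairing (X N1) v)"
      by (rule norm_triangle_sub)
    also have "\<dots> \<le> ip_norm kip (X N1) * sqrt (sq v) + 1 * sqrt (sq v)"
      using diff[of n v N1] mult_right_mono[OF less_imp_le[OF N1[OF \<open>N1 \<le> n\<close>]], of "sqrt (sq v)"]
        pairing_le_ip_norm[OF X, of N1 v] by (simp add: sq_nonneg)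
    finally show "cmod (pairing (X n) v) \<le> B * sqrt (sq v)" by (simp add: B_def distrib_right)
  qed
  have point: "(\<lambda>n. \<langle>X n z, b\<rangle>) \<longlonglongrightarrow> l [(z, b)]" for z b
    using l[of "[(z, b)]"] by simp
  have "\<exists>g. \<forall>b. \<langle>g, b\<rangle> = l [(z, b)]" for z
  proof (rule ex_cdual)
    show "l [(z, x + y)] = l [(z, x)] + l [(z, y)]" for x y
      using tendsto_add[OF point point, of z x z y] point[of z "x + y"] LIMSEQ_unique
      by (simp add: cdual_add_right) blast
    show "l [(z, c *\<^sub>C x)] = cnj c * l [(z, x)]" for c x
      using tendsto_mult_left[OF point, of "cnj c" z x] point[of z "c *\<^sub>C x"] LIMSEQ_unique
      by (simp add: cdual_scaleC_right) blast
    show "cmod (l [(z, b)]) \<le> B * sqrt (norm (K z z)) * norm b" for b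
    proof -
      have "sq [(z, b)] \<le> cmod \<langle>K z z *\<^sub>V b, b\<rangle>"
        using complex_Re_le_cmod by (simp add: gram_def comb_Cons)
      also have "\<dots> \<le> norm (K z z) * norm b * norm b"
        using norm_cdual_apply[of "K z z *\<^sub>V b" b] norm_cblinfun_apply[of "K z z" b]
          mult_right_mono[OF _ norm_ge_zero] by (meson order_trans)
      finally have "sqrt (sq [(z, b)]) \<le> sqrt (norm (K z z)) * norm b"
        using real_sqrt_le_mono by (fastforce simp: real_sqrt_mult mult.assoc)
      then show ?thesis
        using l_le[of "[(z, b)]"] mult_left_mono[OF _ \<open>0 \<le> B\<close>] by (fastforce simp: mult.assoc)
    qed
  qed
  then obtain L where L: "\<And>z b. \<langle>L z, b\<rangle> = l [(z, b)]" by metis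
  have pairing_X: "(\<lambda>n. pairing (X n) v) \<longlonglongrightarrow> pairing L v" for v
  proof (induction v)
    case (Cons p v)
    then show ?case using point by (cases p) (auto simp: L intro!: tendsto_add)
  qed simp
  have "cmod (pairing L v) \<le> B * sqrt (sq v)" for v
    using l_le[of v] LIMSEQ_unique[OF pairing_X l] by simp
  then have L_mem: "L \<in> kspace"
    using \<open>0 \<le> B\<close> by (auto simp: kspace_def)
  have "(\<lambda>n. ip_norm kip (X n - L)) \<longlonglongrightarrow> 0"
  proof (rule LIMSEQ_I)
    fix e :: real assume "0 < e"
    then obtain N where N: "\<And>m n. m \<ge> N \<Longrightarrow> n \<ge> N \<Longrightarrow> ip_norm kip (X m - X n) < e / 2"
      using Cauchy[of "e / 2"] by auto
    have "norm (ip_norm kip (X n - L) - 0) < e" if "n \<ge> N" for n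
    proof -
      have "cmod (pairing (X n - L) v) \<le> e / 2 * sqrt (sq v)" for v
      proof (rule LIMSEQ_le_const2)
        show "(\<lambda>m. cmod (pairing (X n) v - pairing (X m) v)) \<longlonglongrightarrow> cmod (pairing (X n - L) v)"
          unfolding pairing_diff by (intro tendsto_intros pairing_X)
        show "\<exists>M. \<forall>m\<ge>M. cmod (pairing (X n) v - pairing (X m) v) \<le> e / 2 * sqrt (sq v)"
        proof (intro exI allI impI)
          fix m assume "N \<le> m"
          show "cmod (pairing (X n) v - pairing (X m) v) \<le> e / 2 * sqrt (sq v)"
            using diff[of n v m]
              mult_right_mono[OF less_imp_le[OF N[OF that \<open>N \<le> m\<close>]], of "sqrt (sq v)"]
            by (simp add: sq_nonneg)
        qed
      qed
      then have "Q (X n - L) \<le> (e / 2)\<^sup>2" by (rule Q_le_if_pairing_le)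
      then have "sqrt (Q (X n - L)) \<le> e / 2"
        using \<open>0 < e\<close> by (intro real_le_lsqrt) (auto simp: Q_nonneg kspace_diff X L_mem)
      moreover have "0 \<le> sqrt (Q (X n - L))"
        by (simp add: Q_nonneg kspace_diff X L_mem)
      ultimately show ?thesis
        using \<open>0 < e\<close> by (simp add: ip_norm_kip kspace_diff X L_mem)
    qed
    then show "\<exists>N. \<forall>n\<ge>N. norm (ip_norm kip (X n - L) - 0) < e" by blast
  qed
  with L_mem show ?thesis by blast
qed

sublocale complex_hilbert_space kspace kip
proof
  show "0 \<in> kspace" using comb_mem[of "[]"] by simp
  show "f + g \<in> kspace" if "f \<in> kspace" "g \<in> kspace" for f g
    using that by (rule kspace_add)
  show "c *\<^sub>C f \<in> kspace" if "f \<in> kspace" for c f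
    using that by (rule kspace_scaleC)
  show "kip (f + g) h = kip f h + kip g h" if "f \<in> kspace" "g \<in> kspace" "h \<in> kspace" for f g h
    using tendsto_add[OF pairing_approx_tendsto[OF that(1,3)] pairing_approx_tendsto[OF that(2,3)]]
      pairing_approx_tendsto[OF kspace_add[OF that(1,2)] that(3)] LIMSEQ_unique
    by (simp add: pairing_add) blast
  show "kip (c *\<^sub>C f) g = c * kip f g" if "f \<in> kspace" "g \<in> kspace" for c f g
    using tendsto_mult_left[OF pairing_approx_tendsto[OF that], of c]
      pairing_approx_tendsto[OF kspace_scaleC[OF that(1)] that(2), of c] LIMSEQ_unique
    by (simp add: pairing_scaleC) blast
  show "kip g f = cnj (kip f g)" if "f \<in> kspace" "g \<in> kspace" for f g
    using that by (rule kip_commute)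
  show "0 < Re (kip f f)" if f: "f \<in> kspace" and "f \<noteq> 0" for f
  proof (rule ccontr)
    assume "\<not> 0 < Re (kip f f)"
    then have "Q f = 0" using Q_nonneg[OF f] by (simp add: Q_eq_kip f)
    then have zero: "pairing f v = 0" for v using pairing_sq_le[OF f, of v] by simp
    have "\<langle>f z, b\<rangle> = 0" for z b using zero[of "[(z, b)]"] by simp
    then have "f = 0" by (intro ext cdual_eqI) (simp add: cdual_rep_eq)
    with \<open>f \<noteq> 0\<close> show False by simp
  qed
  show "\<exists>L\<in>kspace. (\<lambda>n. ip_norm kip (X n - L)) \<longlonglongrightarrow> 0"
    if "\<And>n. X n \<in> kspace"
      and "\<And>e. e > 0 \<Longrightarrow> \<exists>N. \<forall>m\<ge>N. \<forall>n\<ge>N. ip_norm kip (X m - X n) < e" for X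
    using that by (rule kspace_complete)
qed

definition kernel_fun :: "complex \<Rightarrow> 'b \<Rightarrow> complex \<Rightarrow> 'b cdual"
  where "kernel_fun w b = (\<lambda>z. K z w *\<^sub>V b)"

lemma kernel_fun_eq_comb: "kernel_fun w b = comb [(w, b)]"
  by (simp add: kernel_fun_def comb_Cons)

lemma kernel_fun_mem: "kernel_fun w b \<in> kspace"
  by (simp add: kernel_fun_eq_comb comb_mem)

lemma reproducing: "f \<in> kspace \<Longrightarrow> kip f (kernel_fun w b) = \<langle>f w, b\<rangle>"
  by (simp add: kernel_fun_eq_comb kip_comb)

lemma comb_dense:
  assumes "f \<in> kspace" and "e > 0"
  shows "\<exists>u. ip_norm kip (f - comb u) < e"
proof -
  obtain n where n: "1 / real (Suc n) < e\<^sup>2"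
    using nat_approx_posE[of "e\<^sup>2"] \<open>e > 0\<close> by auto
  have "Q (f - comb (approx f n)) < e\<^sup>2"
    using Q_diff_comb_le[OF assms(1), of "approx f n"] energy_approx[OF assms(1), of n] n by linarith
  then have "sqrt (Q (f - comb (approx f n))) < e"
    using \<open>e > 0\<close> by (intro real_less_lsqrt) (auto simp: Q_nonneg kspace_diff assms comb_mem less_imp_le)
  then show ?thesis
    by (auto simp: ip_norm_kip kspace_diff assms comb_mem)
qed

end

section \<open>Isometries determined on a dense subspace\<close>

text \<open>The span of \<open>R\<close> in the direct sum of two copies of the space, kept as a relation: a statement
  about both components follows by induction, and well-definedness of a map is not presupposed.\<close>

inductive pair_span :: "('h::complex_vector \<times> 'h) set \<Rightarrow> 'h \<Rightarrow> 'h \<Rightarrow> bool" for R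
  where
    pair_span_zero: "pair_span R 0 0"
  | pair_span_step: "\<lbrakk>(x, y) \<in> R; pair_span R u v\<rbrakk> \<Longrightarrow> pair_span R (c *\<^sub>C x + u) (c *\<^sub>C y + v)"

lemma pair_span_base: "(x, y) \<in> R \<Longrightarrow> pair_span R (c *\<^sub>C x) (c *\<^sub>C y)"
  using pair_span_step[OF _ pair_span_zero] by fastforce

lemma pair_span_add: "pair_span R x y \<Longrightarrow> pair_span R u v \<Longrightarrow> pair_span R (x + u) (y + v)"
  by (induction rule: pair_span.induct) (auto simp: add.assoc intro: pair_span_step)

lemma pair_span_scaleC: "pair_span R x y \<Longrightarrow> pair_span R (c *\<^sub>C x) (c *\<^sub>C y)"
  by (induction rule: pair_span.induct)
    (auto simp: scaleC_add_right scaleC_scaleC intro: pair_span.intros)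

lemma pair_span_diff:
  assumes "pair_span R x y" "pair_span R u v"
  shows "pair_span R (x - u) (y - v)"
  using pair_span_add[OF assms(1) pair_span_scaleC[OF assms(2), of "-1"]]
  by (simp add: scaleC_minus_one)

context complex_hilbert_space
begin

definition in_closed_domain :: "('h \<times> 'h) set \<Rightarrow> 'h \<Rightarrow> bool"
  where "in_closed_domain R x \<longleftrightarrow> (\<forall>e>0. \<exists>u v. pair_span R u v \<and> \<parallel>u - x\<parallel> < e)"

lemma pair_span_mem:
  assumes "R \<subseteq> H \<times> H" "pair_span R u v"
  shows "u \<in> H" "v \<in> H"
  using assms(2,1) by (induction rule: pair_span.induct) (auto intro: mem_intros)

lemma in_closed_domain_span: "pair_span R u v \<Longrightarrow> in_closed_domain R u"
  unfolding in_closed_domain_def by (metis diff_self hnorm_zero)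

lemma in_closed_domain_add:
  assumes R: "R \<subseteq> H \<times> H" and mem: "x \<in> H" "y \<in> H"
    and "in_closed_domain R x" "in_closed_domain R y"
  shows "in_closed_domain R (x + y)"
  unfolding in_closed_domain_def
proof (intro allI impI)
  fix e :: real assume "0 < e"
  then obtain u v u' v' where span: "pair_span R u v" "pair_span R u' v'"
    and "\<parallel>u - x\<parallel> < e / 2" "\<parallel>u' - y\<parallel> < e / 2"
    using assms(4,5) unfolding in_closed_domain_def by (meson half_gt_zero)
  moreover have "\<parallel>(u + u') - (x + y)\<parallel> \<le> \<parallel>u - x\<parallel> + \<parallel>u' - y\<parallel>"
    using hnorm_triangle[of "u - x" "u' - y"] pair_span_mem[OF R] span mem
    by (simp add: diff_mem add_diff_add)
  ultimately have "\<parallel>(u + u') - (x + y)\<parallel> < e" by linarith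
  then show "\<exists>u v. pair_span R u v \<and> \<parallel>u - (x + y)\<parallel> < e"
    using pair_span_add[OF span] by blast
qed

lemma in_closed_domain_closed:
  assumes R: "R \<subseteq> H \<times> H" and x: "x \<in> H"
    and approx: "\<And>e. e > 0 \<Longrightarrow> \<exists>y\<in>H. in_closed_domain R y \<and> \<parallel>y - x\<parallel> < e"
  shows "in_closed_domain R x"
  unfolding in_closed_domain_def
proof (intro allI impI)
  fix e :: real assume "0 < e"
  then obtain y where y: "y \<in> H" "in_closed_domain R y" "\<parallel>y - x\<parallel> < e / 2"
    using approx[of "e / 2"] by auto
  then obtain u v where u: "pair_span R u v" "\<parallel>u - y\<parallel> < e / 2"
    using \<open>0 < e\<close> unfolding in_closed_domain_def by (meson half_gt_zero)
  then have "\<parallel>u - x\<parallel> < e"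
    using hnorm_diff_triangle[of u y x] pair_span_mem[OF R u(1)] x y by simp
  with u show "\<exists>u v. pair_span R u v \<and> \<parallel>u - x\<parallel> < e" by blast
qed

text \<open>The closure of an isometric linear relation with dense domain is the graph of an isometry:
  norms agree along the closure, so it relates \<open>0\<close> only to \<open>0\<close>, and its domain is all of \<open>H\<close>
  because images of convergent sequences are Cauchy.\<close>

lemma isometry_extending_relation:
  assumes R: "R \<subseteq> H \<times> H"
    and gram: "\<And>x y x' y'. (x, y) \<in> R \<Longrightarrow> (x', y') \<in> R \<Longrightarrow> ip x x' = ip y y'"
    and dense: "\<And>x. x \<in> H \<Longrightarrow> in_closed_domain R x"
  shows "\<exists>V. isometry_in H ip V \<and> (\<forall>(x, y)\<in>R. V x = y)"
proof -
  note mem = pair_span_mem[OF R]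
  have gram1: "ip x u = ip y v" if "pair_span R u v" "(x, y) \<in> R" for x y u v
    using that
  proof (induction rule: pair_span.induct)
    case (pair_span_step x' y' u v c)
    then have "x' \<in> H" "y' \<in> H" "x \<in> H" "y \<in> H" using R by auto
    then show ?case
      using pair_span_step gram[of x y x' y'] mem[of u v] by (simp add: ip_simps)
  qed (use R in auto)
  have gram2: "ip u u' = ip v v'" if "pair_span R u v" "pair_span R u' v'" for u v u' v'
    using that
  proof (induction rule: pair_span.induct)
    case pair_span_zero
    then show ?case using mem by simp
  next
    case (pair_span_step x y u v c)
    then have "x \<in> H" "y \<in> H" using R by auto
    then show ?case
      using pair_span_step gram1[of u' v' x y] mem[of u v] mem[of u' v'] by (simp add: ip_simps)
  qed
  have norm_eq: "\<parallel>u\<parallel> = \<parallel>v\<parallel>" if "pair_span R u v" for u v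
    using gram2[OF that that] by (simp add: ip_norm_def)

  \<comment> \<open>\<open>G\<close> is the closure of the relation in \<open>H \<times> H\<close>.\<close>
  define G where "G x y \<longleftrightarrow> x \<in> H \<and> y \<in> H \<and>
    (\<forall>e>0. \<exists>u v. pair_span R u v \<and> \<parallel>u - x\<parallel> < e \<and> \<parallel>v - y\<parallel> < e)" for x y
  have G_mem: "x \<in> H" "y \<in> H" if "G x y" for x y using that by (auto simp: G_def)
  have G_span: "G u v" if "pair_span R u v" for u v
    using mem[OF that] that unfolding G_def by (metis diff_self hnorm_zero)
  have G_add: "G (x + x') (y + y')" if "G x y" "G x' y'" for x y x' y'
    unfolding G_def
  proof (intro conjI allI impI)
    fix e :: real assume "0 < e"
    then have "0 < e / 2" by simp
    obtain u v where uv: "pair_span R u v" "\<parallel>u - x\<parallel> < e / 2" "\<parallel>v - y\<parallel> < e / 2"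
      using \<open>G x y\<close> \<open>0 < e / 2\<close> unfolding G_def by blast
    obtain u' v' where uv': "pair_span R u' v'" "\<parallel>u' - x'\<parallel> < e / 2" "\<parallel>v' - y'\<parallel> < e / 2"
      using \<open>G x' y'\<close> \<open>0 < e / 2\<close> unfolding G_def by blast
    have "\<parallel>(u + u') - (x + x')\<parallel> < e" "\<parallel>(v + v') - (y + y')\<parallel> < e"
      using hnorm_triangle[of "u - x" "u' - x'"] hnorm_triangle[of "v - y" "v' - y'"]
        uv uv' mem G_mem[OF that(1)] G_mem[OF that(2)] by (simp_all add: diff_mem add_diff_add)
    then show "\<exists>u v. pair_span R u v \<and> \<parallel>u - (x + x')\<parallel> < e \<and> \<parallel>v - (y + y')\<parallel> < e"
      using pair_span_add[OF uv(1) uv'(1)] by blast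
  qed (use G_mem[OF that(1)] G_mem[OF that(2)] in \<open>auto intro: add_mem\<close>)
  have G_scaleC: "G (c *\<^sub>C x) (c *\<^sub>C y)" if "G x y" for c x y
    unfolding G_def
  proof (intro conjI allI impI)
    fix e :: real assume "0 < e"
    define d where "d = e / (cmod c + 1)"
    have "0 < d" using \<open>0 < e\<close> by (simp add: d_def add_nonneg_pos)
    have cd: "cmod c * t < e" if "t < d" "0 \<le> t" for t
    proof -
      have "cmod c * t \<le> (cmod c + 1) * t" using that(2) by (simp add: distrib_right)
      also have "\<dots> < (cmod c + 1) * d" using that(1) by (simp add: add_nonneg_pos)
      also have "\<dots> = e" using add_nonneg_pos[OF norm_ge_zero[of c] zero_less_one] by (simp add: d_def)
      finally show ?thesis .
    qed
    obtain u v where uv: "pair_span R u v" "\<parallel>u - x\<parallel> < d" "\<parallel>v - y\<parallel> < d"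
      using \<open>G x y\<close> \<open>0 < d\<close> unfolding G_def by blast
    have "u - x \<in> H" "v - y \<in> H" using mem[OF uv(1)] G_mem[OF that] by (auto intro: diff_mem)
    then have "\<parallel>c *\<^sub>C u - c *\<^sub>C x\<parallel> < e" "\<parallel>c *\<^sub>C v - c *\<^sub>C y\<parallel> < e"
      using cd uv by (simp_all add: hnorm_scaleC hnorm_nonneg flip: scaleC_diff_right)
    then show "\<exists>u v. pair_span R u v \<and> \<parallel>u - c *\<^sub>C x\<parallel> < e \<and> \<parallel>v - c *\<^sub>C y\<parallel> < e"
      using pair_span_scaleC[OF uv(1)] by blast
  qed (use G_mem[OF that] in \<open>auto intro: scaleC_mem\<close>)
  have G_norm: "\<parallel>y\<parallel> = \<parallel>x\<parallel>" if "G x y" for x y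
  proof -
    have "\<bar>\<parallel>y\<parallel> - \<parallel>x\<parallel>\<bar> \<le> 0 + e" if "0 < e" for e
    proof -
      have "0 < e / 2" using that by simp
      then obtain u v where uv: "pair_span R u v" "\<parallel>u - x\<parallel> < e / 2" "\<parallel>v - y\<parallel> < e / 2"
        using \<open>G x y\<close> unfolding G_def by blast
      note m = mem[OF uv(1)] G_mem[OF \<open>G x y\<close>]
      have "\<parallel>u\<parallel> \<le> \<parallel>u - x\<parallel> + \<parallel>x\<parallel>" "\<parallel>x\<parallel> \<le> \<parallel>u - x\<parallel> + \<parallel>u\<parallel>"
        "\<parallel>v\<parallel> \<le> \<parallel>v - y\<parallel> + \<parallel>y\<parallel>" "\<parallel>y\<parallel> \<le> \<parallel>v - y\<parallel> + \<parallel>v\<parallel>"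
        using hnorm_triangle[of "u - x" x] hnorm_triangle[of "x - u" u]
          hnorm_triangle[of "v - y" y] hnorm_triangle[of "y - v" v] m
        by (simp_all add: diff_mem hnorm_diff_commute[of x u] hnorm_diff_commute[of y v])
      then show ?thesis using uv norm_eq[OF uv(1)] by linarith
    qed
    then have "\<bar>\<parallel>y\<parallel> - \<parallel>x\<parallel>\<bar> \<le> 0" by (rule field_le_epsilon)
    then show ?thesis by simp
  qed
  have G_unique: "y = y'" if "G x y" "G x y'" for x y y'
  proof -
    have "G (x + (-1) *\<^sub>C x) (y + (-1) *\<^sub>C y')" using that by (intro G_add G_scaleC)
    then have "\<parallel>y - y'\<parallel> = 0" using G_norm by (fastforce simp: scaleC_minus_one hnorm_zero)
    then show ?thesis using G_mem[OF that(1)] G_mem[OF that(2)] by (simp add: hnorm_eq_0_iff diff_mem)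
  qed
  have G_total: "\<exists>y. G x y" if x: "x \<in> H" for x
  proof -
    have "\<exists>u v. pair_span R u v \<and> \<parallel>u - x\<parallel> < 1 / real (Suc n)" for n
      using dense[OF x] by (simp add: in_closed_domain_def)
    then obtain U W where span: "\<And>n. pair_span R (U n) (W n)"
      and U: "\<And>n. \<parallel>U n - x\<parallel> < 1 / real (Suc n)" by metis
    have lim: "(\<lambda>n. a * (1 / real (Suc n))) \<longlonglongrightarrow> 0" for a
      using tendsto_mult_left[OF LIMSEQ_inverse_real_of_nat, of a] by (simp add: inverse_eq_divide)
    have "\<exists>y\<in>H. (\<lambda>n. \<parallel>W n - y\<parallel>) \<longlonglongrightarrow> 0"
    proof (rule complete_if_tail_bound)
      show "W n \<in> H" for n using mem[OF span] by blast
      show "(\<lambda>n. 2 * (1 / real (Suc n))) \<longlonglongrightarrow> 0" by (rule lim)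
      fix m n :: nat assume "n \<le> m"
      then have "1 / real (Suc m) \<le> 1 / real (Suc n)" by (simp add: frac_le)
      moreover have "\<parallel>W m - W n\<parallel> = \<parallel>U m - U n\<parallel>"
        using norm_eq[OF pair_span_diff[OF span span]] by simp
      moreover have "\<parallel>U m - U n\<parallel> \<le> \<parallel>U m - x\<parallel> + \<parallel>U n - x\<parallel>"
        using hnorm_diff_triangle[of "U m" x "U n"] mem[OF span] x
        by (simp add: hnorm_diff_commute[of x])
      ultimately show "\<parallel>W m - W n\<parallel> \<le> 2 * (1 / real (Suc n))"
        using U[of m] U[of n] by linarith
    qed
    then obtain y where y: "y \<in> H" "(\<lambda>n. \<parallel>W n - y\<parallel>) \<longlonglongrightarrow> 0" by blast
    have "\<exists>u v. pair_span R u v \<and> \<parallel>u - x\<parallel> < e \<and> \<parallel>v - y\<parallel> < e" if "0 < e" for e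
    proof -
      have "\<forall>\<^sub>F n in sequentially. \<parallel>W n - y\<parallel> < e \<and> 1 * (1 / real (Suc n)) < e"
        using order_tendstoD(2)[OF y(2) that] order_tendstoD(2)[OF lim that]
        by (rule eventually_conj)
      then obtain n where "\<parallel>W n - y\<parallel> < e" "1 / real (Suc n) < e"
        by (auto simp: eventually_sequentially)
      then show ?thesis using span[of n] U[of n] by (meson less_trans)
    qed
    then show ?thesis using x y(1) by (auto simp: G_def)
  qed
  define V where "V x = (THE y. G x y)" for x
  have V_eq: "V x = y" if "G x y" for x y
    unfolding V_def using that G_unique by blast
  have G_V: "G x (V x)" if "x \<in> H" for x
    using G_total[OF that] V_eq by auto
  have "isometry_in H ip V"
    unfolding isometry_in_def
  proof (intro conjI ballI allI)
    show "V x \<in> H" "\<parallel>V x\<parallel> = \<parallel>x\<parallel>" if "x \<in> H" for x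
      using G_mem(2)[OF G_V[OF that]] G_norm[OF G_V[OF that]] .
    show "V (x + y) = V x + V y" if "x \<in> H" "y \<in> H" for x y
      by (rule V_eq[OF G_add[OF G_V[OF that(1)] G_V[OF that(2)]]])
    show "V (c *\<^sub>C x) = c *\<^sub>C V x" if "x \<in> H" for c x
      by (rule V_eq[OF G_scaleC[OF G_V[OF that]]])
  qed
  moreover have "V x = y" if "(x, y) \<in> R" for x y
    using V_eq[OF G_span[OF pair_span_base[OF that, of 1]]] by (simp add: scaleC_one)
  ultimately show ?thesis by blast
qed

end

section \<open>The model of a Caratheodory function\<close>

lemma caratheodory_kernel_apply:
  assumes "cmod z < 1" "cmod w < 1"
  shows "(1 - z * cnj w) * \<langle>caratheodory_kernel \<phi> z w *\<^sub>V b, c\<rangle>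
    = (\<langle>\<phi> z *\<^sub>V b, c\<rangle> + cnj \<langle>\<phi> w *\<^sub>V c, b\<rangle>) / 2"
proof -
  have "cmod (z * cnj w) < 1"
    using mult_strict_mono'[OF assms] by (simp add: norm_mult)
  then have "1 - z * cnj w \<noteq> 0" by auto
  moreover have "d * (1 / (2 * d) * s) = s / 2" if "d \<noteq> 0" for d s :: complex
    using that by simp
  ultimately show ?thesis
    by (simp only: caratheodory_kernel_def cblinfun_rep_eq cdual_rep_eq adjoint_restrict_apply)
qed

text \<open>Vectors attached to points outside \<open>\<Omega>\<close> do not contribute to the extended form; they may be
  replaced by the zero vector at the origin.\<close>

lemma positive_kernel_extend_by_zero:
  assumes pos: "positive_kernel \<Omega> k" and "0 \<in> \<Omega>"
  shows "positive_kernel UNIV (\<lambda>z w. if z \<in> \<Omega> \<and> w \<in> \<Omega> then k z w else 0)"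
  unfolding positive_kernel_def
proof (intro allI impI)
  fix n and z :: "nat \<Rightarrow> complex" and b :: "nat \<Rightarrow> 'a"
  define z' where "z' i = (if z i \<in> \<Omega> then z i else 0)" for i
  define b' where "b' i = (if z i \<in> \<Omega> then b i else 0)" for i
  have zero: "A *\<^sub>V 0 = 0" "\<langle>f, 0\<rangle> = 0" for A :: "('a, 'a cdual) cblinfun" and f :: "'a cdual"
    using cblinfun_scaleC_right[of A 0 0] cdual_scaleC_right[of f 0 0] by simp_all
  have "(\<Sum>i<n. \<Sum>j<n. \<langle>k (z' i) (z' j) *\<^sub>V b' j, b' i\<rangle>) \<in> \<real>\<^sub>\<ge>\<^sub>0"
    using pos \<open>0 \<in> \<Omega>\<close> by (simp add: positive_kernel_def z'_def)
  also have "(\<Sum>i<n. \<Sum>j<n. \<langle>k (z' i) (z' j) *\<^sub>V b' j, b' i\<rangle>) =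
      (\<Sum>i<n. \<Sum>j<n. \<langle>(if z i \<in> \<Omega> \<and> z j \<in> \<Omega> then k (z i) (z j) else 0) *\<^sub>V b j, b i\<rangle>)"
    by (intro sum.cong refl) (auto simp: z'_def b'_def zero cblinfun_rep_eq cdual_rep_eq)
  finally show "(\<Sum>i<n. \<Sum>j<n. \<langle>(if z i \<in> \<Omega> \<and> z j \<in> \<Omega> then k (z i) (z j) else 0) *\<^sub>V b j, b i\<rangle>) \<in> \<real>\<^sub>\<ge>\<^sub>0" .
qed

text \<open>In the reproducing kernel Hilbert space write \<open>k\<^sub>w b\<close> for the kernel function at \<open>w\<close>. The
  identity \<open>k(z,w) - k(z,0) - k(0,w) + k(0,0) = z w\<^sup>* k(z,w)\<close> says that the map
  \<open>w\<^sup>* k\<^sub>w b \<mapsto> k\<^sub>w b - k\<^sub>0 b\<close> preserves inner products. It gives \<open>\<parallel>k\<^sub>w b - k\<^sub>0 b\<parallel> = |w| \<parallel>k\<^sub>w b\<parallel>\<close>,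
  and weak continuity keeps \<open>\<parallel>k\<^sub>w b\<parallel>\<close> bounded near \<open>0\<close>; so \<open>k\<^sub>0 b\<close> is a limit of vectors in the
  domain, which is therefore dense. For the isometric extension \<open>V\<close>, the rule reads
  \<open>(I - w\<^sup>* V) k\<^sub>w b = k\<^sub>0 b\<close>, so that \<open>C b = k\<^sub>0 b\<close> gives \<open>(I - w\<^sup>* V)\<^sup>-\<^sup>1 C b = k\<^sub>w b\<close>.\<close>

lemma caratheodory_function_represents:
  fixes \<phi> :: "complex \<Rightarrow> ('b::complex_banach, 'b cdual) cblinfun"
  assumes \<phi>: "caratheodory_function \<Omega> \<phi>" and \<Omega>: "\<Omega> \<subseteq> ball 0 1"
  shows "\<exists>(H :: (complex \<Rightarrow> 'b cdual) set) ip V C D.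
    representation_data H ip V C D \<and> represents_adjoint \<Omega> \<phi> H ip V C D"
proof -
  have "open \<Omega>" and zero: "0 \<in> \<Omega>" and cont: "weakly_continuous_at_origin \<Omega> \<phi>"
    and pos: "positive_kernel \<Omega> (caratheodory_kernel \<phi>)"
    using \<phi> by (simp_all add: caratheodory_function_def)
  define K where "K z w = (if z \<in> \<Omega> \<and> w \<in> \<Omega> then caratheodory_kernel \<phi> z w else 0)" for z w
  interpret kr: positive_definite_kernel K
    unfolding K_def by unfold_locales (rule positive_kernel_extend_by_zero[OF pos zero])
  let ?k = kr.kernel_fun
  let ?H = kr.kspace
  let ?ip = kr.kip
  have k_mem [simp]: "?k w b \<in> ?H" for w b by (rule kr.kernel_fun_mem)
  have ip_k: "?ip (?k w b) (?k z c) = \<langle>K z w *\<^sub>V b, c\<rangle>" for z w b c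
    using kr.reproducing[OF k_mem] by (simp add: kr.kernel_fun_def)
  have k_add: "?k w (b + c) = ?k w b + ?k w c" and k_scaleC: "?k w (a *\<^sub>C b) = a *\<^sub>C ?k w b" for a b c w
    by (simp_all add: kr.kernel_fun_def fun_eq_iff scaleC_fun_def cblinfun_add_right
        cblinfun_scaleC_right)
  have kernel: "(1 - z * cnj w) * \<langle>K z w *\<^sub>V b, c\<rangle> = (\<langle>\<phi> z *\<^sub>V b, c\<rangle> + cnj \<langle>\<phi> w *\<^sub>V c, b\<rangle>) / 2"
    if "z \<in> \<Omega>" "w \<in> \<Omega>" for z w b c
    using that \<Omega> by (subst caratheodory_kernel_apply[symmetric]) (auto simp: K_def)

  define R where "R = {(cnj w *\<^sub>C ?k w b, ?k w b - ?k 0 b) | w b. w \<in> \<Omega>}"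
  have R_mem: "R \<subseteq> ?H \<times> ?H" by (auto simp: R_def intro: kr.mem_intros)
  have gram: "?ip (cnj w *\<^sub>C ?k w b) (cnj z *\<^sub>C ?k z c) = ?ip (?k w b - ?k 0 b) (?k z c - ?k 0 c)"
    if "w \<in> \<Omega>" "z \<in> \<Omega>" for w z b c
  proof -
    have "\<langle>K z w *\<^sub>V b, c\<rangle> - \<langle>K z 0 *\<^sub>V b, c\<rangle> - \<langle>K 0 w *\<^sub>V b, c\<rangle> + \<langle>K 0 0 *\<^sub>V b, c\<rangle>
        = \<langle>K z w *\<^sub>V b, c\<rangle> - (1 - z * cnj w) * \<langle>K z w *\<^sub>V b, c\<rangle>"
      using kernel[OF that(2) zero, of b c] kernel[OF zero that(1), of b c]
        kernel[OF zero zero, of b c]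
      by (simp add: kernel[OF that(2,1)] field_simps)
    then show ?thesis by (simp add: kr.ip_simps ip_k algebra_simps)
  qed

  have span_k: "pair_span R (?k w b) (inverse (cnj w) *\<^sub>C (?k w b - ?k 0 b))" if "w \<in> \<Omega>" "w \<noteq> 0" for w b
    using that pair_span_base[of "cnj w *\<^sub>C ?k w b" "?k w b - ?k 0 b" R "inverse (cnj w)"]
    by (auto simp: R_def scaleC_scaleC scaleC_one)
  have norm_diff: "(ip_norm ?ip (?k w b - ?k 0 b))\<^sup>2 = (cmod w)\<^sup>2 / (1 - (cmod w)\<^sup>2) * Re \<langle>\<phi> w *\<^sub>V b, b\<rangle>"
    if "w \<in> \<Omega>" for w b
  proof -
    have w1: "(cmod w)\<^sup>2 < 1" using \<Omega> that by (auto simp: power_less_one_iff)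
    have "?ip (?k w b - ?k 0 b) (?k w b - ?k 0 b) = of_real ((cmod w)\<^sup>2) * \<langle>K w w *\<^sub>V b, b\<rangle>"
      by (subst gram[OF that that, symmetric])
        (simp add: kr.ip_simps ip_k complex_norm_square mult_ac del: of_real_power)
    moreover have "of_real (1 - (cmod w)\<^sup>2) * \<langle>K w w *\<^sub>V b, b\<rangle> = of_real (Re \<langle>\<phi> w *\<^sub>V b, b\<rangle>)"
      using kernel[OF that that, of b b]
      by (simp add: complex_norm_square complex_add_cnj del: of_real_power)
    then have "Re (of_real (1 - (cmod w)\<^sup>2) * \<langle>K w w *\<^sub>V b, b\<rangle>) = Re \<langle>\<phi> w *\<^sub>V b, b\<rangle>" by simp
    then have "(1 - (cmod w)\<^sup>2) * Re \<langle>K w w *\<^sub>V b, b\<rangle> = Re \<langle>\<phi> w *\<^sub>V b, b\<rangle>"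
      by (simp del: of_real_diff of_real_power)
    then have "Re \<langle>K w w *\<^sub>V b, b\<rangle> = Re \<langle>\<phi> w *\<^sub>V b, b\<rangle> / (1 - (cmod w)\<^sup>2)"
      using w1 by (simp add: eq_divide_eq mult.commute)
    ultimately show ?thesis
      by (simp add: kr.hnorm_sq kr.diff_mem del: of_real_power)
  qed
  have dense_k: "kr.in_closed_domain R (?k w b)" for w b
  proof -
    consider "w \<notin> \<Omega>" | "w \<in> \<Omega>" "w \<noteq> 0" | "w = 0" by blast
    then show ?thesis
    proof cases
      case 1
      then have "?k w b = 0" by (simp add: kr.kernel_fun_def K_def fun_eq_iff cblinfun_rep_eq)
      then show ?thesis using kr.in_closed_domain_span[OF pair_span_zero] by metis
    next
      case 2
      then show ?thesis using kr.in_closed_domain_span[OF span_k] by blast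
    next
      case 3
      have lim: "((\<lambda>w. (cmod w)\<^sup>2 / (1 - (cmod w)\<^sup>2) * Re \<langle>\<phi> w *\<^sub>V b, b\<rangle>) \<longlongrightarrow>
          (cmod 0)\<^sup>2 / (1 - (cmod 0)\<^sup>2) * Re \<langle>\<phi> 0 *\<^sub>V b, b\<rangle>) (at 0 within \<Omega>)"
        using cont unfolding weakly_continuous_at_origin_def by (intro tendsto_intros) auto
      have "kr.in_closed_domain R (?k 0 b)"
      proof (rule kr.in_closed_domain_closed[OF R_mem k_mem])
        fix e :: real assume "0 < e"
        then have "(cmod 0)\<^sup>2 / (1 - (cmod 0)\<^sup>2) * Re \<langle>\<phi> 0 *\<^sub>V b, b\<rangle> < e\<^sup>2" by simp
        from order_tendstoD(2)[OF lim this]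
        have "\<forall>\<^sub>F w in at 0 within \<Omega>.
            (cmod w)\<^sup>2 / (1 - (cmod w)\<^sup>2) * Re \<langle>\<phi> w *\<^sub>V b, b\<rangle> < e\<^sup>2 \<and> w \<in> \<Omega> \<and> w \<noteq> 0"
          by (simp add: eventually_at_filter eventually_conj_iff)
        moreover have "at 0 within \<Omega> \<noteq> bot"
          using at_within_open[OF zero \<open>open \<Omega>\<close>] by simp
        ultimately obtain w where w: "w \<in> \<Omega>" "w \<noteq> 0"
          and "(cmod w)\<^sup>2 / (1 - (cmod w)\<^sup>2) * Re \<langle>\<phi> w *\<^sub>V b, b\<rangle> < e\<^sup>2"
          using eventually_happens' by blast
        then have "(ip_norm ?ip (?k w b - ?k 0 b))\<^sup>2 < e\<^sup>2" by (simp add: norm_diff)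
        then have "ip_norm ?ip (?k w b - ?k 0 b) < e"
          using \<open>0 < e\<close> by (simp add: power2_less_imp_less)
        then show "\<exists>y\<in>?H. kr.in_closed_domain R y \<and> ip_norm ?ip (y - ?k 0 b) < e"
          using kr.in_closed_domain_span[OF span_k[OF w, of b]] k_mem by blast
      qed
      then show ?thesis by (simp add: 3)
    qed
  qed
  have dense_comb: "kr.in_closed_domain R (kr.comb u)" for u
  proof (induction u)
    case Nil
    show ?case unfolding kr.comb_Nil by (rule kr.in_closed_domain_span[OF pair_span_zero])
  next
    case (Cons p u)
    have "kr.comb (p # u) = ?k (fst p) (snd p) + kr.comb u"
      using kr.comb_append[of "[p]" u] by (simp add: kr.kernel_fun_eq_comb)
    then show ?case
      using kr.in_closed_domain_add[OF R_mem k_mem kr.comb_mem dense_k Cons] by (simp only:)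
  qed
  have dense: "kr.in_closed_domain R f" if f: "f \<in> ?H" for f
  proof (rule kr.in_closed_domain_closed[OF R_mem f])
    fix e :: real assume "0 < e"
    then obtain u where "ip_norm ?ip (f - kr.comb u) < e" using kr.comb_dense[OF f] by blast
    then have "ip_norm ?ip (kr.comb u - f) < e"
      using kr.hnorm_diff_commute[OF f kr.comb_mem[of u]] by simp
    then show "\<exists>y\<in>?H. kr.in_closed_domain R y \<and> ip_norm ?ip (y - f) < e"
      using dense_comb[of u] kr.comb_mem[of u] by blast
  qed
  have gram_R: "?ip x x' = ?ip y y'" if "(x, y) \<in> R" "(x', y') \<in> R" for x y x' y'
    using that gram by (auto simp: R_def)
  from kr.isometry_extending_relation[OF R_mem gram_R dense]
  obtain V where V: "isometry_in ?H ?ip V" and "\<forall>(x, y)\<in>R. V x = y" by blast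
  then have V_R: "V x = y" if "(x, y) \<in> R" for x y using that by auto
  have V_k: "cnj w *\<^sub>C V (?k w b) = ?k w b - ?k 0 b" if "w \<in> \<Omega>" for w b
  proof -
    have "V (cnj w *\<^sub>C ?k w b) = ?k w b - ?k 0 b" using that by (intro V_R) (auto simp: R_def)
    then show ?thesis using V by (simp add: isometry_in_def)
  qed

  have C: "bounded_op_into ?H ?ip (?k 0)"
    unfolding bounded_op_into_def
  proof (intro conjI allI exI)
    fix b
    have "(ip_norm ?ip (?k 0 b))\<^sup>2 \<le> cmod \<langle>K 0 0 *\<^sub>V b, b\<rangle>"
      by (simp add: kr.hnorm_sq ip_k complex_Re_le_cmod)
    also have "\<dots> \<le> norm (K 0 0) * norm b * norm b"
      using norm_cdual_apply[of "K 0 0 *\<^sub>V b" b] norm_cblinfun_apply[of "K 0 0" b]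
        mult_right_mono[OF _ norm_ge_zero] by (meson order_trans)
    also have "\<dots> = (sqrt (norm (K 0 0)) * norm b)\<^sup>2"
      by (simp add: power_mult_distrib power2_eq_square)
    finally show "ip_norm ?ip (?k 0 b) \<le> sqrt (norm (K 0 0)) * norm b"
      by (rule power2_le_imp_le) simp
  qed (simp_all add: k_add k_scaleC)
  \<comment> \<open>Evaluating \<open>2 k\<^sub>w b - k\<^sub>0 b\<close> at the origin gives \<open>\<phi>(w)\<^sup>* b + (\<phi>(0) - \<phi>(0)\<^sup>*) b / 2\<close>.\<close>
  define D where "D = (1/2) *\<^sub>C (adjoint_restrict (\<phi> 0) - \<phi> 0)"
  have D_apply: "\<langle>D *\<^sub>V b, c\<rangle> = (cnj \<langle>\<phi> 0 *\<^sub>V c, b\<rangle> - \<langle>\<phi> 0 *\<^sub>V b, c\<rangle>) / 2" for b c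
    by (simp add: D_def cblinfun_rep_eq cdual_rep_eq adjoint_restrict_apply)
  have D: "D + adjoint_restrict D = 0"
    by (intro cblinfun_eqI cdual_eqI)
      (simp add: cblinfun_rep_eq cdual_rep_eq adjoint_restrict_apply D_apply
        flip: add_divide_distrib)
  have "represents_adjoint \<Omega> \<phi> ?H ?ip V (?k 0) D"
    unfolding kr.represents_adjoint_iff[OF V C \<Omega>]
  proof (intro ballI allI)
    fix z b c assume z: "z \<in> \<Omega>"
    have "cmod (cnj z) < 1" using z \<Omega> by auto
    then have "kr.resolvent V (cnj z) (?k 0 b) = ?k z b"
      by (intro kr.resolvent_eqI isometry_imp_contraction[OF V]) (simp_all add: V_k z)
    then show "\<langle>\<phi> z *\<^sub>V c, b\<rangle> = cnj (\<langle>D *\<^sub>V b, c\<rangle> +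
        ?ip (2 *\<^sub>C kr.resolvent V (cnj z) (?k 0 b) - ?k 0 b) (?k 0 c))"
      using kernel[OF zero z, of b c] kernel[OF zero zero, of b c]
      by (simp add: kr.ip_simps ip_k D_apply field_simps)
  qed
  moreover have "representation_data ?H ?ip V (?k 0) D"
    using kr.complex_hilbert_space_axioms V C D by (simp add: representation_data_def)
  ultimately show ?thesis by blast
qed

(* HOL cannot quantify existentially over types, so the Hilbert space in the two existence
   claims is sought among spaces of 'b cdual-valued functions of a complex variable (where the
   reproducing kernel Hilbert space of the kernel lives). The remaining claims about
   representations are for Hilbert spaces in an arbitrary ambient space 'h. *)
theorem theorem5p2:
  fixes \<Omega> :: "complex set"
    and \<phi> :: "complex \<Rightarrow> ('b::complex_banach, 'b cdual) cblinfun"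
  assumes "open \<Omega>" and "0 \<in> \<Omega>" and "\<Omega> \<subseteq> ball 0 1"
    and "weakly_continuous_at_origin \<Omega> \<phi>"
  shows
    "(caratheodory_function \<Omega> \<phi> \<longleftrightarrow>
        (\<exists>(H :: (complex \<Rightarrow> 'b cdual) set) ip V C D.
           representation_data H ip V C D \<and> represents_adjoint \<Omega> \<phi> H ip V C D)) \<and>
     (caratheodory_function \<Omega> \<phi> \<longleftrightarrow>
        (\<exists>(H :: (complex \<Rightarrow> 'b cdual) set) ip V C D.
           representation_data H ip V C D \<and> represents \<Omega> \<phi> H ip V C D)) \<and>
     (\<forall>(H :: 'h::complex_vector set) ip V C D.
        representation_data H ip V C D \<longrightarrow>
          (represents_adjoint \<Omega> \<phi> H ip V C D \<longleftrightarrow> represents \<Omega> \<phi> H ip V C D) \<and>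
          (represents_adjoint \<Omega> \<phi> H ip V C D \<longrightarrow> caratheodory_function \<Omega> \<phi>)) \<and>
     (caratheodory_function \<Omega> \<phi> \<longrightarrow>
        (\<exists>\<psi> :: complex \<Rightarrow> ('b, 'b cdual) cblinfun.
           (\<forall>z\<in>\<Omega>. \<psi> z = \<phi> z) \<and> vector_holomorphic_on \<psi> (ball 0 1)))"
proof -
  have data: "complex_hilbert_space H ip" "isometry_in H ip V" "bounded_op_into H ip C"
    "D + adjoint_restrict D = 0"
    if "representation_data H ip V C D" for H :: "'k::complex_vector set" and ip V C
      and D :: "('b, 'b cdual) cblinfun"
    using that by (simp_all add: representation_data_def)
  \<comment> \<open>The type of the ambient space stays schematic: both facts are used for function spaces and for
      \<open>'h\<close>.\<close>
  note equiv = complex_hilbert_space.represents_adjoint_iff_represents[OF data(1-3) assms(3)]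
  note pos = complex_hilbert_space.positive_kernel_if_represents_adjoint[OF data(1-3) assms(3) data(4)]
  have adjoint_iff: "caratheodory_function \<Omega> \<phi> \<longleftrightarrow>
      (\<exists>(H :: (complex \<Rightarrow> 'b cdual) set) ip V C D.
         representation_data H ip V C D \<and> represents_adjoint \<Omega> \<phi> H ip V C D)"
    using caratheodory_function_represents[OF _ assms(3)] pos assms
    unfolding caratheodory_function_def by blast
  have iff: "caratheodory_function \<Omega> \<phi> \<longleftrightarrow>
      (\<exists>(H :: (complex \<Rightarrow> 'b cdual) set) ip V C D.
         representation_data H ip V C D \<and> represents \<Omega> \<phi> H ip V C D)"
    unfolding adjoint_iff using equiv by blast
  have extension: "\<exists>\<psi>. (\<forall>z\<in>\<Omega>. \<psi> z = \<phi> z) \<and> vector_holomorphic_on \<psi> (ball 0 1)"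
    if "caratheodory_function \<Omega> \<phi>"
  proof -
    obtain H :: "(complex \<Rightarrow> 'b cdual) set" and ip V C D
      where rep: "representation_data H ip V C D" "represents \<Omega> \<phi> H ip V C D"
      using \<open>caratheodory_function \<Omega> \<phi>\<close> iff by blast
    show ?thesis
      by (rule complex_hilbert_space.holomorphic_extension_if_represents
          [OF data(1-3)[OF rep(1)] assms(3) rep(2)])
  qed
  have "(represents_adjoint \<Omega> \<phi> H ip V C D \<longleftrightarrow> represents \<Omega> \<phi> H ip V C D) \<and>
      (represents_adjoint \<Omega> \<phi> H ip V C D \<longrightarrow> caratheodory_function \<Omega> \<phi>)"
    if "representation_data H ip V C D" for H :: "'h set" and ip V C D
    using equiv[OF that that that] pos[OF that that that that] assms
    by (simp add: caratheodory_function_def)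
  then show ?thesis using adjoint_iff iff extension by blast
qed

end
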